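(* Let $d$ be a positive integer, let $\Gamma$ be a closed subgroup of $\mathrm{E}(d)$ that contains $\mathbb{R}^d$ (the translations), and let $\Pi_1$ be a glueable abstract pattern space over $(\mathbb{R}^d,\Gamma)$. Let $\mathcal{P}\in\Pi_1$ be an abstract pattern which consists of bounded components and is Delone-deriving. Then there is a Delone set $D$ in $\mathbb{R}^d$ that is mutually locally derivable with $\mathcal{P}$ (where $D$ is viewed as an element of the abstract pattern space of uniformly discrete subsets of $\mathbb{R}^d$ over $(\mathbb{R}^d,\Gamma)$).
   Context: Conventions: $\mathbb{R}^d$ carries the Euclidean metric $\rho$; $B(x,r)$ is the closed ball; $\mathrm{E}(d)\cong\mathbb{R}^d\rtimes\mathrm{O}(d)$ is the group of all isometries of $\mathbb{R}^d$. $\mathrm{Cl}(X)$ is the set of closed subsets of $X$. Abstract pattern space: for a topological space $X$, an abstract pattern space over $X$ is a non-empty set $\Pi$ with a map $\Pi\times\mathrm{Cl}(X)\to\Pi$, $(\mathcal{P},C)\mapsto\mathcal{P}\wedge C$ such that (1) $(\mathcal{P}\wedge C_1)\wedge C_2=\mathcal{P}\wedge(C_1\cap C_2)$ always; (2) for each $\mathcal{P}\in\Pi$ there is a closed set $C_{\mathcal P}$ (necessarily unique), denoted $\operatorname{supp}\mathcal{P}$, such that for every $C\in\mathrm{Cl}(X)$: $\mathcal{P}\wedge C=\mathcal{P}\iff C\supset C_{\mathcal P}$. If a group $\Gamma$ acts on $X$ by homeomorphisms, an abstract pattern space over $(X,\Gamma)$ is an abstract pattern space $\Pi$ over $X$ with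 an action of $\Gamma$ on $\Pi$ such that $(\gamma\mathcal{P})\wedge(\gamma C)=\gamma(\mathcal{P}\wedge C)$ always. Elements of $\Pi$ are called abstract patterns. Glueing ($X$ a metric space): $\mathcal{P}\geqq\mathcal{Q}$ means $\mathcal{P}\wedge\operatorname{supp}\mathcal{Q}=\mathcal{Q}$; this is a partial order, and $\bigvee\Xi$ denotes the supremum of $\Xi\subset\Pi$ if it exists. $\Xi\wedge C=\{\mathcal{P}\wedge C\mid\mathcal{P}\in\Xi\}$. $\mathcal{P},\mathcal{Q}\in\Pi$ are compatible if some $\mathcal{R}\in\Pi$ satisfies $\mathcal{R}\geqq\mathcal{P}$ and $\mathcal{R}\geqq\mathcal{Q}$. $\Xi\subset\Pi$ is pairwise compatible if any two of its elements are compatible, and locally finite if $\Xi\wedge B(x,r)$ is finite for all $x\in X$, $r>0$. $\Pi$ is glueable if every locally finite and pairwise compatible $\Xi\subset\Pi$ has a supremum and satisfies $\bigvee(\Xi\wedge C)=(\bigvee\Xi)\wedge C$ for all $C\in\mathrm{Cl}(X)$. Bounded components: $\mathcal{P}$ consists of bounded components if there is $R_{\mathcal P}>0$ such that for every closed $C$ and every $x\in\operatorname{supp}(\mathcal{P}\wedge C)$ we have $x\in\operatorname{supp}(\mathcal{P}\wedge C\wedge B(x,R_{\mathcal P}))$. Local derivability: let $\Gamma$ act by isometries on proper metric spaces $X,Y$, and let $\mathcal{P}_1,\mathcal{P}_2$ be abstract patterns in abstract pattern spaces over $(X,\Gamma)$, $(Y,\Gamma)$. $\mathcal{P}_2$ is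 locally derivable from $\mathcal{P}_1$ if there are $x_0\in X$, $y_0\in Y$, $R_0\geqq0$ such that for all $\gamma,\eta\in\Gamma$, $R\geqq0$: $(\gamma\mathcal{P}_1)\wedge B(x_0,R+R_0)=(\eta\mathcal{P}_1)\wedge B(x_0,R+R_0)$ implies $(\gamma\mathcal{P}_2)\wedge B(y_0,R)=(\eta\mathcal{P}_2)\wedge B(y_0,R)$. They are mutually locally derivable (MLD) if each is locally derivable from the other. Delone sets: $D\subset X$ is uniformly discrete if for some $r>0$, $\rho(x,y)>r$ for all distinct $x,y\in D$; relatively dense if for some $R>0$, $D$ meets the interior of $B(x,R)$ for every $x\in X$; Delone if both. The set $\mathrm{UD}(X)$ of uniformly discrete subsets is an abstract pattern space over $(X,\Gamma)$ with $D\wedge C=D\cap C$ and $\gamma D=\{\gamma x\mid x\in D\}$. $\mathcal{P}$ is Delone-deriving if some Delone set $D$ in $X$ (viewed in $\mathrm{UD}(X)$) is locally derivable from $\mathcal{P}$. *)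

theory Defs
  imports "HOL-Analysis.Analysis" "HOL-Algebra.Group_Action"
begin

unbundle no m_inv_syntax

section \<open>Abstract pattern spaces\<close>

text \<open>The set of abstract patterns is a carrier set \<open>PS\<close>; \<open>wedge P C\<close> is the cut-off
  operation. It is only constrained on closed \<open>C\<close>.\<close>

locale abstract_pattern_space =
  fixes PS :: "'p set" and wedge :: "'p \<Rightarrow> 'x::topological_space set \<Rightarrow> 'p"
  assumes nonempty: "PS \<noteq> {}"
    and wedge_closed: "\<lbrakk>P \<in> PS; closed C\<rbrakk> \<Longrightarrow> wedge P C \<in> PS"
    and wedge_wedge: "\<lbrakk>P \<in> PS; closed C; closed C'\<rbrakk> \<Longrightarrow> wedge (wedge P C) C' = wedge P (C \<inter> C')"
    and ex_supp: "P \<in> PS \<Longrightarrow> \<exists>S. closed S \<and> (\<forall>C. closed C \<longrightarrow> (wedge P C = P \<longleftrightarrow> S \<subseteq> C))"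

definition supp :: "('p \<Rightarrow> 'x::topological_space set \<Rightarrow> 'p) \<Rightarrow> 'p \<Rightarrow> 'x set" where
  "supp wedge P = (THE S. closed S \<and> (\<forall>C. closed C \<longrightarrow> (wedge P C = P \<longleftrightarrow> S \<subseteq> C)))"

lemma (in abstract_pattern_space) supp:
  assumes "P \<in> PS"
  shows "closed (supp wedge P)" and "closed C \<Longrightarrow> wedge P C = P \<longleftrightarrow> supp wedge P \<subseteq> C"
proof -
  have "\<exists>!S. closed S \<and> (\<forall>C. closed C \<longrightarrow> (wedge P C = P \<longleftrightarrow> S \<subseteq> C))"
    using ex_supp[OF assms] by (metis subset_antisym order_refl)
  from theI'[OF this] show "closed (supp wedge P)" "closed C \<Longrightarrow> wedge P C = P \<longleftrightarrow> supp wedge P \<subseteq> C"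
    unfolding supp_def by blast+
qed

text \<open>\<open>\<phi>\<close> is the action of \<open>G\<close> on the space, \<open>act\<close> the action on patterns.\<close>

locale abstract_pattern_space_over = abstract_pattern_space PS wedge +
    space: group_action G "UNIV :: 'x set" \<phi> + pattern: group_action G PS act
  for G :: "('g, 'm) monoid_scheme" and \<phi> :: "'g \<Rightarrow> 'x::topological_space \<Rightarrow> 'x"
    and PS :: "'p set" and wedge :: "'p \<Rightarrow> 'x set \<Rightarrow> 'p" and act :: "'g \<Rightarrow> 'p \<Rightarrow> 'p" +
  assumes continuous: "\<gamma> \<in> carrier G \<Longrightarrow> continuous_on UNIV (\<phi> \<gamma>)"
    and equivariant: "\<lbrakk>\<gamma> \<in> carrier G; P \<in> PS; closed C\<rbrakk>
      \<Longrightarrow> wedge (act \<gamma> P) (\<phi> \<gamma> ` C) = act \<gamma> (wedge P C)"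


section \<open>Glueing\<close>

definition pattern_order :: "'p set \<Rightarrow> ('p \<Rightarrow> 'x::topological_space set \<Rightarrow> 'p) \<Rightarrow> 'p gorder" where
  "pattern_order PS wedge =
     \<lparr>carrier = PS, eq = (=), le = (\<lambda>Q P. wedge P (supp wedge Q) = Q)\<rparr>"

lemma (in abstract_pattern_space) partial_order_pattern_order:
  "partial_order (pattern_order PS wedge)"
proof -
  have refl: "wedge P (supp wedge P) = P" if "P \<in> PS" for P
    using that supp by blast
  have mono: "supp wedge Q \<subseteq> supp wedge P"
    if "P \<in> PS" "Q \<in> PS" "wedge P (supp wedge Q) = Q" for P Q
  proof -
    have "wedge Q (supp wedge P) = wedge P (supp wedge P \<inter> supp wedge Q)"
      using that wedge_wedge[of P "supp wedge Q" "supp wedge P"] supp(1) by (simp add: Int_commute)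
    also have "\<dots> = wedge (wedge P (supp wedge P)) (supp wedge Q)"
      using that wedge_wedge[of P "supp wedge P" "supp wedge Q"] supp(1) by simp
    also have "\<dots> = Q"
      using that refl[of P] by simp
    finally show ?thesis
      using that supp by blast
  qed
  have trans: "wedge P (supp wedge S) = S"
    if "P \<in> PS" "Q \<in> PS" "S \<in> PS" "wedge P (supp wedge Q) = Q" "wedge Q (supp wedge S) = S" for P Q S
    using that mono[of Q S] wedge_wedge[of P "supp wedge Q" "supp wedge S"] supp(1)
    by (simp add: Int_absorb1)
  have antisym: "P = Q" if "P \<in> PS" "Q \<in> PS" "wedge P (supp wedge Q) = Q" "wedge Q (supp wedge P) = P" for P Q
    using that mono[of P Q] mono[of Q P] refl by (metis subset_antisym)
  show ?thesis
    by unfold_locales (auto simp: pattern_order_def intro: refl trans antisym)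
qed

definition compatible :: "'p set \<Rightarrow> ('p \<Rightarrow> 'x::topological_space set \<Rightarrow> 'p) \<Rightarrow> 'p \<Rightarrow> 'p \<Rightarrow> bool" where
  "compatible PS wedge P Q \<longleftrightarrow>
     (\<exists>S \<in> PS. P \<sqsubseteq>\<^bsub>pattern_order PS wedge\<^esub> S \<and> Q \<sqsubseteq>\<^bsub>pattern_order PS wedge\<^esub> S)"

definition pairwise_compatible ::
    "'p set \<Rightarrow> ('p \<Rightarrow> 'x::topological_space set \<Rightarrow> 'p) \<Rightarrow> 'p set \<Rightarrow> bool" where
  "pairwise_compatible PS wedge \<Xi> \<longleftrightarrow> (\<forall>P \<in> \<Xi>. \<forall>Q \<in> \<Xi>. compatible PS wedge P Q)"

definition wedge_all :: "('p \<Rightarrow> 'x set \<Rightarrow> 'p) \<Rightarrow> 'p set \<Rightarrow> 'x set \<Rightarrow> 'p set" where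
  "wedge_all wedge \<Xi> C = (\<lambda>P. wedge P C) ` \<Xi>"

definition locally_finite_patterns :: "('p \<Rightarrow> 'x::metric_space set \<Rightarrow> 'p) \<Rightarrow> 'p set \<Rightarrow> bool" where
  "locally_finite_patterns wedge \<Xi> \<longleftrightarrow> (\<forall>x. \<forall>r>0. finite (wedge_all wedge \<Xi> (cball x r)))"

text \<open>The family \<open>\<Xi>\<close> may be empty, so a glueable space has a least element.\<close>

definition glueable :: "'p set \<Rightarrow> ('p \<Rightarrow> 'x::metric_space set \<Rightarrow> 'p) \<Rightarrow> bool" where
  "glueable PS wedge \<longleftrightarrow>
     (\<forall>\<Xi> \<subseteq> PS. locally_finite_patterns wedge \<Xi> \<and> pairwise_compatible PS wedge \<Xi> \<longrightarrow>
        (\<exists>S. is_lub (pattern_order PS wedge) S \<Xi> \<and>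
             (\<forall>C. closed C \<longrightarrow> is_lub (pattern_order PS wedge) (wedge S C) (wedge_all wedge \<Xi> C))))"

definition bounded_components :: "('p \<Rightarrow> 'x::metric_space set \<Rightarrow> 'p) \<Rightarrow> 'p \<Rightarrow> bool" where
  "bounded_components wedge P \<longleftrightarrow>
     (\<exists>R>0. \<forall>C. closed C \<longrightarrow>
        (\<forall>x \<in> supp wedge (wedge P C). x \<in> supp wedge (wedge (wedge P C) (cball x R))))"


section \<open>Local derivability\<close>

text \<open>\<open>locally_derivable G wedge1 act1 P1 wedge2 act2 P2\<close>: \<open>P2\<close> is locally derivable from \<open>P1\<close>.\<close>

definition locally_derivable ::
    "('g, 'm) monoid_scheme \<Rightarrow>
     ('p \<Rightarrow> 'x::metric_space set \<Rightarrow> 'p) \<Rightarrow> ('g \<Rightarrow> 'p \<Rightarrow> 'p) \<Rightarrow> 'p \<Rightarrow>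
     ('q \<Rightarrow> 'y::metric_space set \<Rightarrow> 'q) \<Rightarrow> ('g \<Rightarrow> 'q \<Rightarrow> 'q) \<Rightarrow> 'q \<Rightarrow> bool" where
  "locally_derivable G wedge1 act1 P1 wedge2 act2 P2 \<longleftrightarrow>
     (\<exists>x0 y0. \<exists>R0\<ge>0. \<forall>\<gamma> \<in> carrier G. \<forall>\<eta> \<in> carrier G. \<forall>R\<ge>0.
        wedge1 (act1 \<gamma> P1) (cball x0 (R + R0)) = wedge1 (act1 \<eta> P1) (cball x0 (R + R0)) \<longrightarrow>
        wedge2 (act2 \<gamma> P2) (cball y0 R) = wedge2 (act2 \<eta> P2) (cball y0 R))"

definition mutually_locally_derivable ::
    "('g, 'm) monoid_scheme \<Rightarrow>
     ('p \<Rightarrow> 'x::metric_space set \<Rightarrow> 'p) \<Rightarrow> ('g \<Rightarrow> 'p \<Rightarrow> 'p) \<Rightarrow> 'p \<Rightarrow>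
     ('q \<Rightarrow> 'y::metric_space set \<Rightarrow> 'q) \<Rightarrow> ('g \<Rightarrow> 'q \<Rightarrow> 'q) \<Rightarrow> 'q \<Rightarrow> bool" where
  "mutually_locally_derivable G wedge1 act1 P1 wedge2 act2 P2 \<longleftrightarrow>
     locally_derivable G wedge1 act1 P1 wedge2 act2 P2 \<and>
     locally_derivable G wedge2 act2 P2 wedge1 act1 P1"


section \<open>Delone sets\<close>

definition uniformly_discrete :: "'x::metric_space set \<Rightarrow> bool" where
  "uniformly_discrete D \<longleftrightarrow> (\<exists>r>0. \<forall>x \<in> D. \<forall>y \<in> D. x \<noteq> y \<longrightarrow> dist x y > r)"

definition relatively_dense :: "'x::metric_space set \<Rightarrow> bool" where
  "relatively_dense D \<longleftrightarrow> (\<exists>R>0. \<forall>x. D \<inter> interior (cball x R) \<noteq> {})"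

definition delone :: "'x::metric_space set \<Rightarrow> bool" where
  "delone D \<longleftrightarrow> uniformly_discrete D \<and> relatively_dense D"

text \<open>Uniformly discrete sets form an abstract pattern space with \<open>(\<inter>)\<close> as cut-off. The
  restriction in \<open>UD_act\<close> is needed because \<^const>\<open>BijGroup\<close> consists of extensional maps.\<close>

definition UD :: "'x::metric_space set set" where
  "UD = {D. uniformly_discrete D}"

definition UD_act :: "('g \<Rightarrow> 'x::metric_space \<Rightarrow> 'x) \<Rightarrow> 'g \<Rightarrow> 'x set \<Rightarrow> 'x set" where
  "UD_act \<phi> \<gamma> = (\<lambda>D \<in> UD. \<phi> \<gamma> ` D)"

definition delone_deriving ::
    "('g, 'm) monoid_scheme \<Rightarrow> ('g \<Rightarrow> 'x::metric_space \<Rightarrow> 'x) \<Rightarrow>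
     ('p \<Rightarrow> 'x set \<Rightarrow> 'p) \<Rightarrow> ('g \<Rightarrow> 'p \<Rightarrow> 'p) \<Rightarrow> 'p \<Rightarrow> bool" where
  "delone_deriving G \<phi> wedge act P \<longleftrightarrow>
     (\<exists>D. delone D \<and> locally_derivable G wedge act P (\<inter>) (UD_act \<phi>) D)"

lemma uniformly_discrete_imp_closed: "uniformly_discrete D \<Longrightarrow> closed D"
  unfolding uniformly_discrete_def
  by (metis discrete_imp_closed dist_commute not_less_iff_gr_or_eq)

lemma abstract_pattern_space_UD:
  "abstract_pattern_space (UD :: 'x::metric_space set set) (\<inter>)"
proof
  have "uniformly_discrete ({} :: 'x set)"
    by (auto simp: uniformly_discrete_def intro: exI[of _ 1])
  then show "(UD :: 'x set set) \<noteq> {}"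
    by (auto simp: UD_def)
next
  fix P C :: "'x set"
  assume "P \<in> UD" "closed C"
  then show "P \<inter> C \<in> UD"
    by (auto simp: UD_def uniformly_discrete_def)
next
  fix P :: "'x set"
  assume "P \<in> UD"
  then show "\<exists>S. closed S \<and> (\<forall>C. closed C \<longrightarrow> (P \<inter> C = P \<longleftrightarrow> S \<subseteq> C))"
    by (intro exI[of _ P]) (auto simp: UD_def uniformly_discrete_imp_closed)
qed auto

lemma abstract_pattern_space_over_UD:
  fixes \<phi> :: "'g \<Rightarrow> 'x::metric_space \<Rightarrow> 'x"
  assumes "group_action G UNIV \<phi>"
    and isom: "\<And>\<gamma> x y. \<gamma> \<in> carrier G \<Longrightarrow> dist (\<phi> \<gamma> x) (\<phi> \<gamma> y) = dist x y"
  shows "abstract_pattern_space_over G \<phi> UD (\<inter>) (UD_act \<phi>)"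
proof -
  interpret space: group_action G "UNIV :: 'x set" \<phi> by fact
  interpret UD: abstract_pattern_space "UD :: 'x set set" "(\<inter>)"
    by (rule abstract_pattern_space_UD)
  interpret group G using space.group_hom by (simp add: group_hom_def)
  have mem: "\<phi> \<gamma> ` D \<in> UD" if "\<gamma> \<in> carrier G" "D \<in> UD" for \<gamma> D
    using that isom[OF that(1)] by (fastforce simp: UD_def uniformly_discrete_def)
  have mult: "\<phi> (\<gamma> \<otimes>\<^bsub>G\<^esub> \<eta>) x = \<phi> \<gamma> (\<phi> \<eta> x)"
    if "\<gamma> \<in> carrier G" "\<eta> \<in> carrier G" for \<gamma> \<eta> x
    using space.composition_rule[of x \<gamma> \<eta>] that by simp
  have one: "\<phi> \<one>\<^bsub>G\<^esub> x = x" for x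
    using space.id_eq_one by (metis UNIV_I restrict_apply)
  have cancel: "\<phi> (m_inv G \<gamma>) (\<phi> \<gamma> x) = x" "\<phi> \<gamma> (\<phi> (m_inv G \<gamma>) x) = x"
    if "\<gamma> \<in> carrier G" for \<gamma> x
    using mult[of "m_inv G \<gamma>" \<gamma> x] mult[of \<gamma> "m_inv G \<gamma>" x] that one by simp_all
  have bij: "UD_act \<phi> \<gamma> \<in> Bij UD" if "\<gamma> \<in> carrier G" for \<gamma>
  proof -
    have "bij_betw (UD_act \<phi> \<gamma>) UD UD"
      by (rule bij_betw_byWitness[where f' = "\<lambda>D. \<phi> (m_inv G \<gamma>) ` D"])
         (use that in \<open>auto simp: UD_act_def image_image cancel mem\<close>)
    then show ?thesis
      by (simp add: Bij_def UD_act_def)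
  qed
  have "UD_act \<phi> \<in> hom G (BijGroup UD)"
  proof (rule homI)
    fix \<gamma> \<eta> assume g: "\<gamma> \<in> carrier G" "\<eta> \<in> carrier G"
    show "UD_act \<phi> (\<gamma> \<otimes>\<^bsub>G\<^esub> \<eta>) = UD_act \<phi> \<gamma> \<otimes>\<^bsub>BijGroup UD\<^esub> UD_act \<phi> \<eta>"
    proof -
      have "UD_act \<phi> (\<gamma> \<otimes>\<^bsub>G\<^esub> \<eta>) = compose UD (UD_act \<phi> \<gamma>) (UD_act \<phi> \<eta>)"
        using g mem by (auto simp: UD_act_def compose_def image_image mult fun_eq_iff restrict_def)
      then show ?thesis
        using bij g by (simp add: BijGroup_def)
    qed
  qed (use bij in \<open>auto simp: BijGroup_def\<close>)
  then interpret pattern: group_action G "UD :: 'x set set" "UD_act \<phi>"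
    by (simp add: group_action_def group_hom_def group_hom_axioms_def group_BijGroup is_group)
  show ?thesis
  proof
    fix \<gamma> assume g: "\<gamma> \<in> carrier G"
    show "continuous_on UNIV (\<phi> \<gamma>)"
      unfolding continuous_on_iff using isom[OF g] by metis
    fix D C :: "'x set" assume "D \<in> UD" "closed C"
    moreover have "inj (\<phi> \<gamma>)"
      using cancel(1)[OF g] by (metis injI)
    ultimately show "UD_act \<phi> \<gamma> D \<inter> \<phi> \<gamma> ` C = UD_act \<phi> \<gamma> (D \<inter> C)"
      using UD.wedge_closed by (simp add: UD_act_def image_Int)
  qed
qed


section \<open>The Euclidean group\<close>

definition isometry_group :: "('x::metric_space \<Rightarrow> 'x) monoid" where
  "isometry_group =
     \<lparr>carrier = {f. surj f \<and> (\<forall>x y. dist (f x) (f y) = dist x y)}, mult = (\<circ>), one = id\<rparr>"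

lemma group_isometry_group: "group (isometry_group :: ('x::metric_space \<Rightarrow> 'x) monoid)"
proof (rule groupI)
  fix f :: "'x \<Rightarrow> 'x" assume "f \<in> carrier isometry_group"
  then have f: "surj f" "\<And>x y. dist (f x) (f y) = dist x y"
    by (auto simp: isometry_group_def)
  then have "inj f"
    by (metis dist_eq_0_iff injI)
  with f have "inv f \<in> carrier isometry_group" "inv f \<circ> f = id"
    by (auto simp: isometry_group_def surj_f_inv_f inj_imp_surj_inv)
       (metis surj_f_inv_f)
  then show "\<exists>g \<in> carrier isometry_group. g \<otimes>\<^bsub>isometry_group\<^esub> f = \<one>\<^bsub>isometry_group\<^esub>"
    by (auto simp: isometry_group_def)
next
  fix f g :: "'x \<Rightarrow> 'x"
  assume "f \<in> carrier isometry_group" "g \<in> carrier isometry_group"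
  then show "f \<otimes>\<^bsub>isometry_group\<^esub> g \<in> carrier isometry_group"
    using comp_surj[of g f] by (simp add: isometry_group_def)
qed (auto simp: isometry_group_def comp_assoc)

lemma group_action_isometry_group:
  assumes "subgroup \<Gamma> (isometry_group :: ('x::metric_space \<Rightarrow> 'x) monoid)"
  shows "group_action (isometry_group\<lparr>carrier := \<Gamma>\<rparr>) UNIV (\<lambda>\<gamma>. \<gamma>)"
proof -
  have bij: "\<gamma> \<in> Bij UNIV" if "\<gamma> \<in> \<Gamma>" for \<gamma>
  proof -
    have "surj \<gamma>" "\<And>x y. dist (\<gamma> x) (\<gamma> y) = dist x y"
      using subgroup.subset[OF assms] that by (auto simp: isometry_group_def)
    moreover from this have "inj \<gamma>"
      by (metis dist_eq_0_iff injI)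
    ultimately show ?thesis
      by (simp add: Bij_def bij_betw_def)
  qed
  have "(\<lambda>\<gamma>. \<gamma>) \<in> hom (isometry_group\<lparr>carrier := \<Gamma>\<rparr>) (BijGroup UNIV)"
    by (rule homI) (simp_all add: bij BijGroup_def isometry_group_def compose_def fun_eq_iff)
  moreover have "group (isometry_group\<lparr>carrier := \<Gamma>\<rparr>)"
    by (rule subgroup.subgroup_is_group[OF assms group_isometry_group])
  ultimately show ?thesis
    by (simp add: group_action_def group_hom_def group_hom_axioms_def group_BijGroup)
qed

text \<open>The topology of \<open>E(d)\<close> is the product topology of \<open>\<real>\<^sup>d \<times> O(d)\<close>, transported along
  \<open>(v, A) \<mapsto> (x \<mapsto> v + A x)\<close>.\<close>

definition closed_subgroup_E :: "((real^'n) \<Rightarrow> (real^'n)) set \<Rightarrow> bool" where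
  "closed_subgroup_E \<Gamma> \<longleftrightarrow>
     subgroup \<Gamma> isometry_group \<and>
     closedin (top_of_set (UNIV \<times> {A :: real^'n^'n. orthogonal_matrix A}))
       {(v, A). orthogonal_matrix A \<and> (\<lambda>x. v + A *v x) \<in> \<Gamma>}"

end

theory Submission
  imports Defs
begin

text \<open>
  A Delone set \<open>D\<close> derived from \<open>P\<close> in general remembers too little of \<open>P\<close>; the missing information is written into small clusters of extra points near the points
  of \<open>D\<close>.

  For a large radius \<open>S\<close> consider the local patches \<open>P \<and> B(x, S)\<close>, \<open>x \<in> D\<close>, up to the elements
  of \<open>G\<close> that carry one centred patch to another.  As \<open>D\<close> is countable, there are at most countably
  many classes, so every class with representative \<open>c\<close> can be given its own length \<open>height c\<close>
  in a fixed compact interval of positive reals.  The cluster at \<open>c\<close> has to have exactly the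
  symmetries of the patch at \<open>c\<close>.  The patch determines \<open>D \<inter> B(c, L)\<close>, and an isometry
  that fixes \<open>D \<inter> B(c, L)\<close> pointwise is the identity when \<open>L\<close> is large
  (\<open>isometry_fixing_dense_patch\<close>); hence a symmetry of the patch is controlled by a permutation of
  a finite set of bounded size.  This gives a unit vector \<open>p\<close> such that all nontrivial
  symmetries of \<open>D \<inter> B(c, L)\<close> fixing \<open>c\<close> move \<open>c + t p\<close> by a distance bounded below uniformly in \<open>c\<close>
  (\<open>exists_direction_separating_points\<close>, \<open>symmetry_moves_tip\<close>).  At \<open>x \<in> D\<close> the cluster \<open>flag x\<close>
  consists of the images of two such points, at distances \<open>height c\<close> and \<open>height c + gap\<close> from
  \<open>c\<close>, under all elements carrying the patch at \<open>c\<close> to the patch at \<open>x\<close>.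

  The new set \<open>marked\<close>, which is \<open>D\<close> together with all flags, is Delone and is derived from \<open>P\<close> by
  construction (\<open>marked_derived_from_P\<close>).  Conversely, points of \<open>D\<close> are those without a
  neighbour at distance \<open>gap\<close>, every flag point has such a neighbour, the smallest distance in a flag tells
  the class of the patch, and the position of the flag tells how the patch is placed
  (\<open>P_motion_at_D\<close>).  So \<open>marked\<close> determines the patches of \<open>P\<close> around points of \<open>D\<close>.  Since \<open>P\<close>
  consists of bounded components, these patches cover \<open>P\<close>, and glueing them determines \<open>P\<close>
  on balls (\<open>wedge_eq_by_glueing\<close>, \<open>P_derived_from_marked\<close>).

  Throughout, local derivability is used in the form given by \<open>locally_derivable_iff_motions\<close>:
  whatever carries a ball-shaped patch of the first pattern to another one also
  carries the slightly smaller patches of the second pattern to each other.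
\<close>

section \<open>Motions between patches of a pattern\<close>

text \<open>For fixed \<open>R\<close> these sets are the morphisms of a groupoid on the points of the space; its
  objects should be thought of as the patches \<open>P \<and> B(x, R)\<close> with marked centre \<open>x\<close>.\<close>

definition motions ::
    "('g, 'm) monoid_scheme \<Rightarrow> ('g \<Rightarrow> 'x::metric_space \<Rightarrow> 'x) \<Rightarrow>
     ('p \<Rightarrow> 'x set \<Rightarrow> 'p) \<Rightarrow> ('g \<Rightarrow> 'p \<Rightarrow> 'p) \<Rightarrow> 'p \<Rightarrow> real \<Rightarrow> 'x \<Rightarrow> 'x \<Rightarrow> 'g set" where
  "motions G \<phi> wedge act P R x y =
     {\<gamma> \<in> carrier G. \<phi> \<gamma> x = y \<and> act \<gamma> (wedge P (cball x R)) = wedge P (cball y R)}"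

lemma cball_subset_cballI:
  fixes x y :: "'x::metric_space"
  shows "dist y x + r \<le> s \<Longrightarrow> cball x r \<subseteq> cball y s"
  by (intro subsetI, unfold mem_cball) (metis add_mono_thms_linordered_semiring(2) dist_triangle order_trans)

context abstract_pattern_space
begin

lemma wedge_self: "P \<in> PS \<Longrightarrow> wedge P (supp wedge P) = P"
  using supp by blast

lemma supp_wedge_subset: "\<lbrakk>P \<in> PS; closed C\<rbrakk> \<Longrightarrow> supp wedge (wedge P C) \<subseteq> C"
  by (metis Int_absorb supp(2) wedge_closed wedge_wedge)

lemma supp_wedge_subset_supp:
  assumes "P \<in> PS" "closed C"
  shows "supp wedge (wedge P C) \<subseteq> supp wedge P"
proof -
  have "wedge (wedge P C) (supp wedge P) = wedge (wedge P (supp wedge P)) C"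
    using assms by (simp add: wedge_wedge supp Int_commute)
  then show ?thesis
    using assms by (simp add: wedge_self supp(1) wedge_closed flip: supp(2))
qed

lemma supp_wedge_mono:
  assumes "P \<in> PS" "closed C" "closed C'" "C \<subseteq> C'"
  shows "supp wedge (wedge P C) \<subseteq> supp wedge (wedge P C')"
proof -
  have "wedge P C = wedge (wedge P C') C"
    using assms by (simp add: wedge_wedge Int_absorb1)
  then show ?thesis
    using supp_wedge_subset_supp[of "wedge P C'" C] assms by (simp add: wedge_closed)
qed

lemma wedge_eq_mono:
  assumes "P \<in> PS" "Q \<in> PS" "closed C" "closed C'" "C \<subseteq> C'" "wedge P C' = wedge Q C'"
  shows "wedge P C = wedge Q C"
  using assms wedge_wedge[of _ C' C] by (metis Int_absorb1)

lemma wedge_piece: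
  assumes "P \<in> PS" "closed C"
  shows "wedge P (supp wedge (wedge P C)) = wedge P C"
  using assms wedge_self[of "wedge P C"] supp_wedge_subset[of P C]
    wedge_wedge[of P C "supp wedge (wedge P C)"]
  by (simp add: wedge_closed supp Int_absorb1)

text \<open>The common cut-offs \<open>P \<and> A i = Q \<and> A i\<close> lie below both patterns, hence so does their
  supremum \<open>S\<close>.  By the covering hypothesis, \<open>P \<and> C\<close> and \<open>Q \<and> C\<close> have their support inside
  that of \<open>S\<close>, so each of them equals \<open>S \<and> C\<close>.\<close>

lemma wedge_eq_by_glueing:
  fixes A :: "'i \<Rightarrow> 'x set"
  assumes glueable: "\<exists>S. is_lub (pattern_order PS wedge) S ((\<lambda>i. wedge P (A i)) ` I)"
    and P: "P \<in> PS" and Q: "Q \<in> PS" and C: "closed C"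
    and A: "\<And>i. i \<in> I \<Longrightarrow> closed (A i)"
    and eq: "\<And>i. i \<in> I \<Longrightarrow> wedge P (A i) = wedge Q (A i)"
    and cover: "supp wedge (wedge P C) \<subseteq> (\<Union>i\<in>I. supp wedge (wedge P (A i)))"
      "supp wedge (wedge Q C) \<subseteq> (\<Union>i\<in>I. supp wedge (wedge Q (A i)))"
  shows "wedge P C = wedge Q C"
proof -
  let ?\<Xi> = "(\<lambda>i. wedge P (A i)) ` I"
  obtain S where "is_lub (pattern_order PS wedge) S ?\<Xi>"
    using glueable by blast
  then have S: "S \<in> PS"
    and ub: "\<And>i. i \<in> I \<Longrightarrow> wedge S (supp wedge (wedge P (A i))) = wedge P (A i)"
    and le: "\<And>U. U \<in> PS \<Longrightarrow> \<forall>i\<in>I. wedge U (supp wedge (wedge P (A i))) = wedge P (A i) \<Longrightarrow>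
               wedge U (supp wedge S) = S"
    by (auto simp: least_def Upper_def pattern_order_def P A wedge_closed)
  have supp_S: "supp wedge (wedge P (A i)) \<subseteq> supp wedge S" if "i \<in> I" for i
    using supp_wedge_subset_supp[OF S, of "supp wedge (wedge P (A i))"] ub[OF that]
    by (simp add: supp P A that wedge_closed)
  have piece: "wedge U C = wedge S C"
    if U: "U \<in> PS" and sU: "wedge U (supp wedge S) = S" "supp wedge (wedge U C) \<subseteq> supp wedge S" for U
  proof -
    have "wedge U C = wedge (wedge U C) (supp wedge S)"
      using sU U C S by (metis supp(1) supp(2) wedge_closed)
    also have "\<dots> = wedge (wedge U (supp wedge S)) C"
      using U C S by (simp add: wedge_wedge supp Int_commute)
    finally show ?thesis
      using sU by simp
  qed
  have "wedge P C = wedge S C"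
    using cover(1) supp_S by (intro piece P le) (auto simp: wedge_piece P A)
  moreover have "wedge Q C = wedge S C"
    using cover(2) supp_S eq A wedge_piece[OF Q] by (intro piece Q le) auto
  ultimately show ?thesis by simp
qed

end

locale isometric_pattern_space = abstract_pattern_space_over G \<phi> PS wedge act
  for G :: "('g, 'm) monoid_scheme" and \<phi> :: "'g \<Rightarrow> 'x::metric_space \<Rightarrow> 'x"
    and PS :: "'p set" and wedge :: "'p \<Rightarrow> 'x set \<Rightarrow> 'p" and act :: "'g \<Rightarrow> 'p \<Rightarrow> 'p" +
  assumes isometric: "\<gamma> \<in> carrier G \<Longrightarrow> dist (\<phi> \<gamma> x) (\<phi> \<gamma> y) = dist x y"
begin

sublocale group G
  using space.group_hom by (simp add: group_hom_def)

abbreviation mot where "mot \<equiv> motions G \<phi> wedge act"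

lemma space_mult: "\<lbrakk>\<gamma> \<in> carrier G; \<eta> \<in> carrier G\<rbrakk> \<Longrightarrow> \<phi> (\<gamma> \<otimes>\<^bsub>G\<^esub> \<eta>) x = \<phi> \<gamma> (\<phi> \<eta> x)"
  using space.composition_rule[of x \<gamma> \<eta>] by simp

lemma space_one [simp]: "\<phi> \<one>\<^bsub>G\<^esub> x = x"
  using space.id_eq_one by (metis UNIV_I restrict_apply)

lemma space_inv [simp]:
  assumes "\<gamma> \<in> carrier G"
  shows "\<phi> (m_inv G \<gamma>) (\<phi> \<gamma> x) = x" "\<phi> \<gamma> (\<phi> (m_inv G \<gamma>) x) = x"
  using assms by (simp_all flip: space_mult)

lemma pattern_mult:
  "\<lbrakk>\<gamma> \<in> carrier G; \<eta> \<in> carrier G; P \<in> PS\<rbrakk> \<Longrightarrow> act (\<gamma> \<otimes>\<^bsub>G\<^esub> \<eta>) P = act \<gamma> (act \<eta> P)"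
  using pattern.composition_rule[of P \<gamma> \<eta>] by simp

lemma pattern_one [simp]: "P \<in> PS \<Longrightarrow> act \<one>\<^bsub>G\<^esub> P = P"
  using pattern.id_eq_one by (metis restrict_apply)

lemma pattern_closed: "\<lbrakk>\<gamma> \<in> carrier G; P \<in> PS\<rbrakk> \<Longrightarrow> act \<gamma> P \<in> PS"
  using pattern.element_image by blast

lemma pattern_inv:
  assumes "\<gamma> \<in> carrier G" "P \<in> PS"
  shows "act (m_inv G \<gamma>) (act \<gamma> P) = P" "act \<gamma> (act (m_inv G \<gamma>) P) = P"
  using assms by (simp_all flip: pattern_mult)

lemma image_cball:
  assumes "\<gamma> \<in> carrier G"
  shows "\<phi> \<gamma> ` cball x R = cball (\<phi> \<gamma> x) R"
proof
  show "cball (\<phi> \<gamma> x) R \<subseteq> \<phi> \<gamma> ` cball x R"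
  proof
    fix y assume "y \<in> cball (\<phi> \<gamma> x) R"
    then have "\<phi> (m_inv G \<gamma>) y \<in> cball x R"
      using isometric[OF assms, of x "\<phi> (m_inv G \<gamma>) y"] assms by simp
    then show "y \<in> \<phi> \<gamma> ` cball x R"
      using assms by (metis image_eqI space_inv(2))
  qed
qed (auto simp: isometric assms)

lemma wedge_act_cball:
  assumes "\<gamma> \<in> carrier G" "P \<in> PS"
  shows "wedge (act \<gamma> P) (cball (\<phi> \<gamma> x) R) = act \<gamma> (wedge P (cball x R))"
  using equivariant[OF assms, of "cball x R"] assms by (simp add: image_cball)

lemma motions_iff:
  assumes "P \<in> PS"
  shows "\<gamma> \<in> mot P R x y \<longleftrightarrow>
    \<gamma> \<in> carrier G \<and> \<phi> \<gamma> x = y \<and> wedge (act \<gamma> P) (cball y R) = wedge P (cball y R)"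
  using assms by (auto simp: motions_def wedge_act_cball)

lemma motions_one: "P \<in> PS \<Longrightarrow> \<one>\<^bsub>G\<^esub> \<in> mot P R x x"
  by (simp add: motions_def wedge_closed)

lemma motions_mult:
  "\<lbrakk>P \<in> PS; \<gamma> \<in> mot P R x y; \<eta> \<in> mot P R y z\<rbrakk> \<Longrightarrow> \<eta> \<otimes>\<^bsub>G\<^esub> \<gamma> \<in> mot P R x z"
  by (auto simp: motions_def space_mult pattern_mult wedge_closed)

lemma motions_inv:
  assumes P: "P \<in> PS" and mot: "\<gamma> \<in> mot P R x y"
  shows "m_inv G \<gamma> \<in> mot P R y x"
proof -
  have g: "\<gamma> \<in> carrier G" "y = \<phi> \<gamma> x" "wedge P (cball y R) = act \<gamma> (wedge P (cball x R))"
    using mot by (auto simp: motions_def)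
  have "act (m_inv G \<gamma>) (wedge P (cball y R)) = wedge P (cball x R)"
    unfolding g(3) using P g(1) by (intro pattern_inv wedge_closed) auto
  then show ?thesis
    using g(1,2) by (simp add: motions_def)
qed

text \<open>A motion of a patch is also a motion of every smaller patch inside, with any centre. It is
  through this lemma that local information about large balls is used at their interior points.\<close>

lemma motions_shrink:
  assumes P: "P \<in> PS" and "\<gamma> \<in> mot P R x y" and "dist x x' + R' \<le> R"
  shows "\<gamma> \<in> mot P R' x' (\<phi> \<gamma> x')"
proof -
  have g: "\<gamma> \<in> carrier G" "y = \<phi> \<gamma> x" and
    eq: "wedge (act \<gamma> P) (cball y R) = wedge P (cball y R)"
    using assms by (auto simp: motions_iff)
  have "dist y (\<phi> \<gamma> x') + R' \<le> R"
    using assms g by (simp add: isometric)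
  then have "cball (\<phi> \<gamma> x') R' \<subseteq> cball y R"
    by (intro cball_subset_cballI)
  then show ?thesis
    using wedge_eq_mono[OF _ _ _ _ _ eq] P g by (simp add: motions_iff pattern_closed)
qed

lemma closed_image:
  assumes "\<gamma> \<in> carrier G" "closed C"
  shows "closed (\<phi> \<gamma> ` C)"
proof -
  have "\<phi> \<gamma> ` C = \<phi> (m_inv G \<gamma>) -` C"
    using assms(1) by (auto simp: image_iff) (metis space_inv(2))
  then show ?thesis
    using closed_vimage[OF assms(2), of "\<phi> (m_inv G \<gamma>)"] continuous assms(1) by simp
qed

lemma supp_act:
  assumes g: "\<gamma> \<in> carrier G" and P: "P \<in> PS"
  shows "supp wedge (act \<gamma> P) = \<phi> \<gamma> ` supp wedge P"
proof -
  have sub: "supp wedge (act \<gamma> P) \<subseteq> \<phi> \<gamma> ` supp wedge P" if "\<gamma> \<in> carrier G" "P \<in> PS" for \<gamma> P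
    using equivariant[OF that, of "supp wedge P"] that
    by (simp add: supp wedge_self closed_image pattern_closed flip: supp(2))
  have "supp wedge P \<subseteq> \<phi> (m_inv G \<gamma>) ` supp wedge (act \<gamma> P)"
    using sub[of "m_inv G \<gamma>" "act \<gamma> P"] g P by (simp add: pattern_closed pattern_inv)
  then have "\<phi> \<gamma> ` supp wedge P \<subseteq> supp wedge (act \<gamma> P)"
    using g by (force simp: image_iff)
  with sub[OF g P] show ?thesis by blast
qed

lemma bounded_components_act:
  assumes g: "\<gamma> \<in> carrier G" and P: "P \<in> PS"
    and bounded: "\<And>C u. \<lbrakk>closed C; u \<in> supp wedge (wedge P C)\<rbrakk> \<Longrightarrow> u \<in> supp wedge (wedge (wedge P C) (cball u b))"
    and C: "closed C" and u: "u \<in> supp wedge (wedge (act \<gamma> P) C)"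
  shows "u \<in> supp wedge (wedge (wedge (act \<gamma> P) C) (cball u b))"
proof -
  let ?C = "\<phi> (m_inv G \<gamma>) ` C"
  have C': "closed ?C" "\<phi> \<gamma> ` ?C = C"
    using g C by (auto simp: closed_image image_image)
  then have piece: "wedge (act \<gamma> P) C = act \<gamma> (wedge P ?C)"
    using equivariant[OF g P C'(1)] by simp
  then obtain v where v: "v \<in> supp wedge (wedge P ?C)" "u = \<phi> \<gamma> v"
    using u g P C' by (auto simp: supp_act wedge_closed)
  have "wedge (wedge (act \<gamma> P) C) (cball u b) = act \<gamma> (wedge (wedge P ?C) (cball v b))"
    unfolding piece v(2) using g P C' by (intro wedge_act_cball wedge_closed)
  moreover have "v \<in> supp wedge (wedge (wedge P ?C) (cball v b))"
    using bounded[OF C'(1) v(1)] .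
  ultimately show ?thesis
    using g P C' v(2) by (simp add: supp_act wedge_closed)
qed

lemma isometric_pattern_space_UD: "isometric_pattern_space G \<phi> UD (\<inter>) (UD_act \<phi>)"
  using abstract_pattern_space_over_UD[OF space.group_action_axioms isometric] isometric
  by (simp add: isometric_pattern_space_def isometric_pattern_space_axioms_def)

text \<open>The pieces are pairwise compatible because they are all cut from \<open>P\<close>.\<close>

lemma finite_pieces_have_lub:
  fixes A :: "'i \<Rightarrow> 'x set"
  assumes glueable: "glueable PS wedge" and P: "P \<in> PS" and "finite I" and A: "\<And>i. i \<in> I \<Longrightarrow> closed (A i)"
  shows "\<exists>S. is_lub (pattern_order PS wedge) S ((\<lambda>i. wedge P (A i)) ` I)"
proof -
  let ?\<Xi> = "(\<lambda>i. wedge P (A i)) ` I"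
  have "?\<Xi> \<subseteq> PS"
    using P A by (auto intro: wedge_closed)
  moreover have "locally_finite_patterns wedge ?\<Xi>"
    using \<open>finite I\<close> by (simp add: locally_finite_patterns_def wedge_all_def)
  moreover have "pairwise_compatible PS wedge ?\<Xi>"
    using P A by (auto simp: pairwise_compatible_def compatible_def pattern_order_def
        wedge_piece intro!: bexI[of _ P])
  ultimately have "\<exists>S. is_lub (pattern_order PS wedge) S ?\<Xi> \<and>
      (\<forall>C. closed C \<longrightarrow> is_lub (pattern_order PS wedge) (wedge S C) (wedge_all wedge ?\<Xi> C))"
    using glueable[unfolded glueable_def, rule_format, of ?\<Xi>] by simp
  then show ?thesis
    by (elim exE conjE) (rule exI)
qed

end

text \<open>The definition compares two translates of the same pattern at one fixed pair of base
  points.  Multiplying by the inverse of one group element turns this into a motion of the pattern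
  itself.  The base points can be moved to an arbitrary common point because the action is
  transitive and isometric; the distance between them is absorbed into the radius \<open>R\<^sub>0\<close>.\<close>

lemma locally_derivable_iff_motions:
  fixes \<phi> :: "'g \<Rightarrow> 'x::metric_space \<Rightarrow> 'x"
  assumes "isometric_pattern_space G \<phi> PS\<^sub>1 wedge\<^sub>1 act\<^sub>1" and "isometric_pattern_space G \<phi> PS\<^sub>2 wedge\<^sub>2 act\<^sub>2"
    and P: "P\<^sub>1 \<in> PS\<^sub>1" "P\<^sub>2 \<in> PS\<^sub>2"
    and transitive: "\<And>x y. \<exists>\<gamma>\<in>carrier G. \<phi> \<gamma> x = y"
  shows "locally_derivable G wedge\<^sub>1 act\<^sub>1 P\<^sub>1 wedge\<^sub>2 act\<^sub>2 P\<^sub>2 \<longleftrightarrow>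
    (\<exists>R\<^sub>0\<ge>0. \<forall>R\<ge>0. \<forall>x y. motions G \<phi> wedge\<^sub>1 act\<^sub>1 P\<^sub>1 (R + R\<^sub>0) x y \<subseteq> motions G \<phi> wedge\<^sub>2 act\<^sub>2 P\<^sub>2 R x y)"
    (is "?derivable \<longleftrightarrow> ?motions")
proof -
  interpret A: isometric_pattern_space G \<phi> PS\<^sub>1 wedge\<^sub>1 act\<^sub>1 by fact
  interpret B: isometric_pattern_space G \<phi> PS\<^sub>2 wedge\<^sub>2 act\<^sub>2 by fact
  show ?thesis
  proof
    assume ?derivable
    then obtain x0 y0 R0 where R0: "R0 \<ge> 0" and transfer_eq:
      "\<And>\<gamma> \<eta> R. \<lbrakk>\<gamma> \<in> carrier G; \<eta> \<in> carrier G; R \<ge> 0;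
         wedge\<^sub>1 (act\<^sub>1 \<gamma> P\<^sub>1) (cball x0 (R + R0)) = wedge\<^sub>1 (act\<^sub>1 \<eta> P\<^sub>1) (cball x0 (R + R0))\<rbrakk> \<Longrightarrow>
         wedge\<^sub>2 (act\<^sub>2 \<gamma> P\<^sub>2) (cball y0 R) = wedge\<^sub>2 (act\<^sub>2 \<eta> P\<^sub>2) (cball y0 R)"
      unfolding locally_derivable_def by blast
    have "\<gamma> \<in> motions G \<phi> wedge\<^sub>2 act\<^sub>2 P\<^sub>2 R x y"
      if R: "R \<ge> 0" and mot: "\<gamma> \<in> motions G \<phi> wedge\<^sub>1 act\<^sub>1 P\<^sub>1 (R + (R0 + dist x0 y0)) x y" for R \<gamma> x y
    proof -
      let ?R = "R + dist x0 y0"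
      have g: "\<gamma> \<in> carrier G" "\<phi> \<gamma> x = y"
        and eq: "wedge\<^sub>1 (act\<^sub>1 \<gamma> P\<^sub>1) (cball y (?R + R0)) = wedge\<^sub>1 P\<^sub>1 (cball y (?R + R0))"
        using mot P by (auto simp: A.motions_iff ac_simps)
      obtain \<tau> where t: "\<tau> \<in> carrier G" "\<phi> \<tau> y = x0"
        using transitive by blast
      have "wedge\<^sub>1 (act\<^sub>1 (\<tau> \<otimes>\<^bsub>G\<^esub> \<gamma>) P\<^sub>1) (cball x0 (?R + R0)) = wedge\<^sub>1 (act\<^sub>1 \<tau> P\<^sub>1) (cball x0 (?R + R0))"
        using A.wedge_act_cball[of \<tau> _ y "?R + R0"] eq t g P by (simp add: A.pattern_mult A.pattern_closed)
      then have eq2: "wedge\<^sub>2 (act\<^sub>2 (\<tau> \<otimes>\<^bsub>G\<^esub> \<gamma>) P\<^sub>2) (cball y0 ?R) = wedge\<^sub>2 (act\<^sub>2 \<tau> P\<^sub>2) (cball y0 ?R)"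
        using R t g by (intro transfer_eq) auto
      let ?z = "\<phi> (m_inv G \<tau>) y0"
      have "act\<^sub>2 \<tau> (wedge\<^sub>2 (act\<^sub>2 \<gamma> P\<^sub>2) (cball ?z ?R)) = act\<^sub>2 \<tau> (wedge\<^sub>2 P\<^sub>2 (cball ?z ?R))"
        using B.wedge_act_cball[of \<tau> _ ?z ?R] eq2 t g P by (simp add: B.pattern_mult B.pattern_closed)
      then have eq3: "wedge\<^sub>2 (act\<^sub>2 \<gamma> P\<^sub>2) (cball ?z ?R) = wedge\<^sub>2 P\<^sub>2 (cball ?z ?R)"
        using B.pattern_inv(1)[OF t(1)] P g by (metis B.pattern_closed B.wedge_closed closed_cball)
      have "dist y ?z = dist x0 y0"
        using A.isometric[OF t(1), of y ?z] t by simp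
      then have "cball y R \<subseteq> cball ?z ?R"
        by (intro cball_subset_cballI) (simp add: dist_commute)
      then show ?thesis
        using B.wedge_eq_mono[OF _ _ _ _ _ eq3] P g by (simp add: B.motions_iff B.pattern_closed)
    qed
    then show ?motions
      using R0 by (intro exI[of _ "R0 + dist x0 y0"]) auto
  next
    assume ?motions
    then obtain R0 where R0: "R0 \<ge> 0" and transfer_eq:
      "\<And>R x y. R \<ge> 0 \<Longrightarrow> motions G \<phi> wedge\<^sub>1 act\<^sub>1 P\<^sub>1 (R + R0) x y \<subseteq> motions G \<phi> wedge\<^sub>2 act\<^sub>2 P\<^sub>2 R x y"
      by blast
    have "wedge\<^sub>2 (act\<^sub>2 \<gamma> P\<^sub>2) (cball x0 R) = wedge\<^sub>2 (act\<^sub>2 \<eta> P\<^sub>2) (cball x0 R)"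
      if g: "\<gamma> \<in> carrier G" "\<eta> \<in> carrier G" and R: "R \<ge> 0"
        and eq: "wedge\<^sub>1 (act\<^sub>1 \<gamma> P\<^sub>1) (cball x0 (R + R0)) = wedge\<^sub>1 (act\<^sub>1 \<eta> P\<^sub>1) (cball x0 (R + R0))"
      for \<gamma> \<eta> R x0
    proof -
      let ?x = "\<phi> (m_inv G \<gamma>) x0" and ?y = "\<phi> (m_inv G \<eta>) x0" and ?h = "m_inv G \<eta> \<otimes>\<^bsub>G\<^esub> \<gamma>"
      have "act\<^sub>1 \<gamma> (wedge\<^sub>1 P\<^sub>1 (cball ?x (R + R0))) = act\<^sub>1 \<eta> (wedge\<^sub>1 P\<^sub>1 (cball ?y (R + R0)))"
        using eq A.wedge_act_cball[of \<gamma> P\<^sub>1 ?x "R + R0"] A.wedge_act_cball[of \<eta> P\<^sub>1 ?y "R + R0"] g P by simp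
      then have "?h \<in> motions G \<phi> wedge\<^sub>1 act\<^sub>1 P\<^sub>1 (R + R0) ?x ?y"
        using g P by (simp add: motions_def A.space_mult A.pattern_mult A.wedge_closed A.pattern_inv)
      then have "?h \<in> motions G \<phi> wedge\<^sub>2 act\<^sub>2 P\<^sub>2 R ?x ?y"
        using transfer_eq R by blast
      then have "act\<^sub>2 (m_inv G \<eta>) (act\<^sub>2 \<gamma> (wedge\<^sub>2 P\<^sub>2 (cball ?x R))) = wedge\<^sub>2 P\<^sub>2 (cball ?y R)"
        using g P by (simp add: motions_def B.pattern_mult B.wedge_closed)
      then have "act\<^sub>2 \<gamma> (wedge\<^sub>2 P\<^sub>2 (cball ?x R)) = act\<^sub>2 \<eta> (wedge\<^sub>2 P\<^sub>2 (cball ?y R))"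
        using g P by (metis B.pattern_inv(2) B.pattern_closed B.wedge_closed closed_cball)
      then show ?thesis
        using B.wedge_act_cball[of \<gamma> P\<^sub>2 ?x R] B.wedge_act_cball[of \<eta> P\<^sub>2 ?y R] g P by simp
    qed
    then show ?derivable
      using R0 unfolding locally_derivable_def by blast
  qed
qed


section \<open>Separated sets and Euclidean isometries\<close>

text \<open>By total boundedness a ball of radius \<open>L\<close> is covered by finitely many balls of radius
  \<open>r/2\<close>, each of which contains at most one point of \<open>D\<close>.  That the bound is the same for all
  \<open>D\<close> and all centres is what makes the later constructions uniform.\<close>

lemma separated_card_bound:
  fixes r L :: real
  assumes "r > 0"
  obtains N where "\<And>(D :: 'x::euclidean_space set) c.
    \<forall>x\<in>D. \<forall>y\<in>D. x \<noteq> y \<longrightarrow> dist x y > r \<Longrightarrow> finite (D \<inter> cball c L) \<and> card (D \<inter> cball c L) \<le> N"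
proof -
  obtain K :: "'x set" where K: "finite K" "cball 0 L \<subseteq> (\<Union>k\<in>K. ball k (r/2))"
    using compact_cball[of "0 :: 'x" L] half_gt_zero[OF assms] unfolding compact_eq_totally_bounded
    by blast
  show thesis
  proof (rule that)
    fix D :: "'x set" and c
    assume D: "\<forall>x\<in>D. \<forall>y\<in>D. x \<noteq> y \<longrightarrow> dist x y > r"
    have "\<exists>k\<in>K. y - c \<in> ball k (r/2)" if "y \<in> cball c L" for y
    proof -
      have "y - c \<in> cball 0 L"
        using that by (simp add: dist_norm norm_minus_commute)
      with K(2) show ?thesis by blast
    qed
    then obtain f where f: "\<And>y. y \<in> cball c L \<Longrightarrow> f y \<in> K \<and> y - c \<in> ball (f y) (r/2)"
      by metis
    have "inj_on f (D \<inter> cball c L)"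
    proof (rule inj_onI)
      fix x y assume xy: "x \<in> D \<inter> cball c L" "y \<in> D \<inter> cball c L" "f x = f y"
      then have "dist (x - c) (y - c) < r"
        using f[of x] f[of y] dist_triangle_half_l[of "x - c" "f x" r "y - c"]
        by (auto simp: dist_commute)
      then show "x = y"
        using D xy by (force simp: dist_norm)
    qed
    moreover have "f ` (D \<inter> cball c L) \<subseteq> K"
      using f by auto
    ultimately show "finite (D \<inter> cball c L) \<and> card (D \<inter> cball c L) \<le> card K"
      using K(1) by (meson card_inj_on_le inj_on_finite)
  qed
qed

lemma separated_countable:
  fixes D :: "'x::euclidean_space set"
  assumes "r > 0" "\<forall>x\<in>D. \<forall>y\<in>D. x \<noteq> y \<longrightarrow> dist x y > r"
  shows "countable D"
proof -
  have "finite (D \<inter> cball 0 (real n))" for n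
    using separated_card_bound[OF assms(1)] assms(2) by metis
  moreover have "D = (\<Union>n. D \<inter> cball 0 (real n))"
    using real_arch_simple by (auto simp: dist_norm)
  ultimately show ?thesis
    by (metis countable_UN countable_finite countableI_type)
qed

text \<open>Add the unit vectors one at a time: moving \<open>p\<close> by half of the present bound along the new
  vector \<open>v\<close>, on the side where \<open>p\<close> already lies, makes \<open>p \<bullet> v\<close> large and at most halves the
  other products; normalising costs another factor of two.\<close>

lemma exists_direction_away_from_hyperplanes:
  fixes W :: "'x::euclidean_space set"
  assumes "finite W" "\<And>w. w \<in> W \<Longrightarrow> norm w = 1"
  shows "\<exists>p. norm p = 1 \<and> (\<forall>w\<in>W. (1/4) ^ card W \<le> \<bar>p \<bullet> w\<bar>)"
  using assms
proof (induction W rule: finite_induct)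
  case empty
  then show ?case
    using norm_Basis nonempty_Basis by (metis card.empty empty_iff ex_in_conv)
next
  case (insert v W)
  let ?s = "(1/4 :: real) ^ card W"
  have s: "0 < ?s" "?s \<le> 1"
    by (auto simp: power_le_one)
  obtain p where p: "norm p = 1" "\<And>w. w \<in> W \<Longrightarrow> ?s \<le> \<bar>p \<bullet> w\<bar>"
    using insert by auto
  have v: "norm v = 1" and W: "\<And>w. w \<in> W \<Longrightarrow> norm w = 1"
    using insert by auto
  define t where "t = (if p \<bullet> v \<ge> 0 then ?s/2 else - (?s/2))"
  have t: "\<bar>t\<bar> = ?s/2"
    using s by (simp add: t_def)
  define q where "q = p + t *\<^sub>R v"
  have vv: "v \<bullet> v = 1"
    using v by (simp add: norm_eq_1)
  have "?s/2 \<le> \<bar>q \<bullet> v\<bar>"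
    using s(1) by (auto simp: q_def t_def inner_add_left vv abs_if)
  moreover have "?s/2 \<le> \<bar>q \<bullet> w\<bar>" if "w \<in> W" for w
  proof -
    have "\<bar>t * (v \<bullet> w)\<bar> \<le> ?s/2"
      using Cauchy_Schwarz_ineq2[of v w] v W[OF that] s by (simp add: abs_mult t mult_left_le)
    then show ?thesis
      using p(2)[OF that] unfolding q_def inner_add_left inner_scaleR_left by linarith
  qed
  ultimately have q: "?s/2 \<le> \<bar>q \<bullet> w\<bar>" if "w \<in> insert v W" for w
    using that by blast
  have "norm q \<le> norm p + norm (t *\<^sub>R v)"
    unfolding q_def by (rule norm_triangle_ineq)
  then have norm: "norm q \<le> 2"
    using p(1) v t s by simp
  have "q \<noteq> 0"
  proof
    assume "q = 0"
    then have "?s/2 \<le> 0"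
      using q[of v] by simp
    with s(1) show False by linarith
  qed
  have "(1/4) ^ card (insert v W) \<le> \<bar>sgn q \<bullet> w\<bar>" if "w \<in> insert v W" for w
  proof -
    have "(1/4) ^ card (insert v W) = (?s/2) / 2"
      using insert by simp
    also have "\<dots> \<le> \<bar>q \<bullet> w\<bar> / norm q"
      using q[OF that] norm s \<open>q \<noteq> 0\<close> by (intro frac_le) auto
    also have "\<dots> = \<bar>sgn q \<bullet> w\<bar>"
      by (simp add: sgn_div_norm abs_mult divide_inverse)
    finally show ?thesis .
  qed
  then show ?case
    using \<open>q \<noteq> 0\<close> by (intro exI[of _ "sgn q"]) (auto simp: norm_sgn)
qed

text \<open>There are at most \<open>N * N\<close> normalised differences of points of \<open>A\<close>.  The bound is explicit
  to show that it depends on \<open>A\<close> only through \<open>N\<close> and \<open>r\<close>.\<close>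

lemma exists_direction_separating_points:
  fixes A :: "'x::euclidean_space set"
  assumes A: "finite A" "card A \<le> N" and r: "\<forall>y\<in>A. \<forall>z\<in>A. y \<noteq> z \<longrightarrow> dist y z > r" "r > 0"
  shows "\<exists>p. norm p = 1 \<and> (\<forall>y\<in>A. \<forall>z\<in>A. y \<noteq> z \<longrightarrow> r * (1/4) ^ (N * N) \<le> \<bar>p \<bullet> (y - z)\<bar>)"
proof -
  let ?W = "(\<lambda>(y, z). sgn (y - z)) ` {(y, z) \<in> A \<times> A. y \<noteq> z}"
  have fin: "finite (A \<times> A)" using A by blast
  have "finite {(y, z) \<in> A \<times> A. y \<noteq> z}"
    by (rule finite_subset[OF _ fin]) auto
  then have fin_W: "finite ?W" and "card ?W \<le> card {(y, z) \<in> A \<times> A. y \<noteq> z}"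
    by (auto intro: card_image_le)
  note this(2)
  also have "card {(y, z) \<in> A \<times> A. y \<noteq> z} \<le> card (A \<times> A)"
    by (rule card_mono[OF fin]) auto
  also have "\<dots> \<le> N * N"
    using A by (simp add: card_cartesian_product mult_le_mono)
  finally have W: "finite ?W" "card ?W \<le> N * N"
    using fin_W by auto
  obtain p where p: "norm p = 1" "\<And>w. w \<in> ?W \<Longrightarrow> (1/4) ^ card ?W \<le> \<bar>p \<bullet> w\<bar>"
    using exists_direction_away_from_hyperplanes[OF W(1)] by (force simp: norm_sgn)
  have "r * (1/4) ^ (N * N) \<le> \<bar>p \<bullet> (y - z)\<bar>" if yz: "y \<in> A" "z \<in> A" "y \<noteq> z" for y z
  proof -
    have "(1/4) ^ (N * N) \<le> ((1/4) ^ card ?W :: real)"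
      using W(2) by (intro power_decreasing) auto
    also have "\<dots> \<le> \<bar>p \<bullet> sgn (y - z)\<bar>"
      using yz by (intro p) force
    finally have "norm (y - z) * (1/4) ^ (N * N) \<le> norm (y - z) * \<bar>p \<bullet> sgn (y - z)\<bar>"
      by (intro mult_left_mono) auto
    also have "\<dots> = \<bar>p \<bullet> (y - z)\<bar>"
      using yz by (simp add: sgn_div_norm abs_mult)
    finally show ?thesis
      using r yz by (smt (verit) dist_norm mult_right_mono zero_le_power zero_le_divide_1_iff)
  qed
  then show ?thesis
    using p(1) by blast
qed

text \<open>If \<open>h\<close> moves \<open>z\<close>, every fixed point of \<open>h\<close> lies on the hyperplane that bisects \<open>z\<close> and
  \<open>h z\<close>.  This hyperplane contains \<open>x\<close>.  An open ball of radius \<open>R\<close> tangent to it at \<open>x\<close> contains a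
  point of \<open>D\<close>, which is fixed but lies strictly on one side.\<close>

lemma isometry_fixing_dense_patch:
  fixes h :: "'x::euclidean_space \<Rightarrow> 'x"
  assumes isometry: "\<And>a b. dist (h a) (h b) = dist a b"
    and dense: "\<And>z. \<exists>y\<in>D. dist z y < R" and R: "R > 0"
    and fixed: "h x = x" "\<And>y. y \<in> D \<inter> cball x (2 * R) \<Longrightarrow> h y = y"
  shows "h z = z"
proof (rule ccontr)
  assume "h z \<noteq> z"
  define u where "u = h z - z"
  then have u: "norm u > 0"
    using \<open>h z \<noteq> z\<close> by simp
  define z0 where "z0 = x + (R / norm u) *\<^sub>R u"
  obtain y where y: "y \<in> D" "dist z0 y < R"
    using dense by blast
  have "dist x z0 = R"
    using u R by (simp add: z0_def dist_norm)
  then have "y \<in> cball x (2 * R)"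
    using y dist_triangle[of x y z0] by simp
  then have "h y = y"
    using fixed y by blast
  then have "norm (y - z) = norm (y - h z)" "norm (x - z) = norm (x - h z)"
    using isometry[of y z] isometry[of x z] fixed(1) by (auto simp: dist_norm)
  then have "(y - z) \<bullet> (y - z) = (y - h z) \<bullet> (y - h z)" "(x - z) \<bullet> (x - z) = (x - h z) \<bullet> (x - h z)"
    by (simp_all add: norm_eq)
  then have "(y - x) \<bullet> u = 0"
    by (simp add: u_def inner_diff inner_commute algebra_simps)
  moreover have "(y - x) \<bullet> u = (y - z0) \<bullet> u + R * norm u"
    using u by (simp add: z0_def inner_diff inner_add_left dot_square_norm power2_eq_square field_simps)
  moreover have "\<bar>(y - z0) \<bullet> u\<bar> < R * norm u"
    using Cauchy_Schwarz_ineq2[of "y - z0" u] y(2) u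
    by (smt (verit) dist_commute dist_norm mult_strict_right_mono)
  ultimately show False by linarith
qed

text \<open>Since \<open>h y\<close> and \<open>y\<close> are equally far from \<open>c\<close>, the difference of the squared distances from
  \<open>z\<close> to them is, up to sign, twice the inner product.  On the other hand the distances themselves differ by at most
  the displacement of \<open>z\<close>, because \<open>dist (h z) (h y) = dist z y\<close>.\<close>

lemma isometry_displacement_bound:
  fixes h :: "'x::euclidean_space \<Rightarrow> 'x"
  assumes isometry: "\<And>a b. dist (h a) (h b) = dist a b"
    and fixed: "h c = c" and near: "dist c y \<le> L" "dist c z \<le> b"
  shows "\<bar>(z - c) \<bullet> (h y - y)\<bar> \<le> (L + b) * dist (h z) z"
proof -
  let ?a = "norm (z - h y)" and ?a' = "norm (z - y)"
  have hy: "dist c (h y) = dist c y"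
    using isometry[of c y] fixed by simp
  then have "norm (h y - c) = norm (y - c)"
    by (simp add: dist_norm norm_minus_commute)
  then have sq: "(h y - c) \<bullet> (h y - c) = (y - c) \<bullet> (y - c)"
    by (simp add: norm_eq)
  have "?a * ?a - ?a' * ?a' = (z - h y) \<bullet> (z - h y) - (z - y) \<bullet> (z - y)"
    by (simp add: dot_square_norm power2_eq_square)
  also have "\<dots> = - 2 * ((z - c) \<bullet> (h y - y))"
    using sq by (simp add: inner_diff inner_commute algebra_simps)
  finally have "2 * \<bar>(z - c) \<bullet> (h y - y)\<bar> = \<bar>?a * ?a - ?a' * ?a'\<bar>"
    by linarith
  also have "\<dots> = \<bar>?a - ?a'\<bar> * (?a + ?a')"
    by (simp add: square_diff_square_factored abs_mult)
  also have "\<dots> \<le> dist (h z) z * (2 * (L + b))"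
  proof (rule mult_mono)
    have "dist (h z) (h y) = ?a'"
      using isometry by (simp add: dist_norm)
    then show "\<bar>?a - ?a'\<bar> \<le> dist (h z) z"
      using dist_triangle[of z "h y" "h z"] dist_triangle[of "h z" "h y" z] by (simp add: dist_norm norm_minus_commute abs_le_iff)
    show "?a + ?a' \<le> 2 * (L + b)"
      using dist_triangle[of z "h y" c] dist_triangle[of z y c] near hy by (simp add: dist_norm norm_minus_commute)
  qed auto
  finally show ?thesis
    by (simp add: algebra_simps)
qed


section \<open>The marked Delone set\<close>

text \<open>The density \<open>L/2\<close> is chosen so that only the identity fixes a patch of \<open>D\<close> of radius
  \<open>L\<close> around a point of \<open>D\<close> pointwise.  Local derivability of \<open>D\<close> enters through the single radius \<open>S\<close>, because
  motions of larger patches of \<open>P\<close> restrict to motions of patches of radius \<open>S\<close>.  The bound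
  \<open>s\<close> has to be common to all \<open>c\<close>, or else the marked set need not be uniformly discrete.\<close>

locale marked_pattern = isometric_pattern_space G \<phi> PS wedge act
  for G :: "('g, 'm) monoid_scheme" and \<phi> :: "'g \<Rightarrow> 'x::euclidean_space \<Rightarrow> 'x"
    and PS :: "'p set" and wedge :: "'p \<Rightarrow> 'x set \<Rightarrow> 'p" and act :: "'g \<Rightarrow> 'p \<Rightarrow> 'p" +
  fixes P :: 'p and D :: "'x set" and r L S s :: real
  assumes faithful: "\<lbrakk>\<gamma> \<in> carrier G; \<And>x. \<phi> \<gamma> x = x\<rbrakk> \<Longrightarrow> \<gamma> = \<one>\<^bsub>G\<^esub>"
    and P: "P \<in> PS"
    and r: "r > 0" and separated: "\<And>x y. \<lbrakk>x \<in> D; y \<in> D; x \<noteq> y\<rbrakk> \<Longrightarrow> dist x y > r"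
    and L: "L > 0" and dense: "\<And>x. \<exists>y\<in>D. dist x y < L / 2"
    and S: "S \<ge> L" and derived: "mot P S x y \<subseteq> motions G \<phi> (\<inter>) (UD_act \<phi>) D L x y"
    and s: "s > 0"
    and directions: "\<And>c. c \<in> D \<Longrightarrow>
      \<exists>p. norm p = 1 \<and> (\<forall>y\<in>D \<inter> cball c L. \<forall>z\<in>D \<inter> cball c L. y \<noteq> z \<longrightarrow> s \<le> \<bar>p \<bullet> (y - z)\<bar>)"
begin

sublocale UD: isometric_pattern_space G \<phi> UD "(\<inter>)" "UD_act \<phi>"
  by (rule isometric_pattern_space_UD)

lemma UD_motions_def:
  "A \<in> UD \<Longrightarrow> UD.mot A R x y = {\<gamma> \<in> carrier G. \<phi> \<gamma> x = y \<and> \<phi> \<gamma> ` (A \<inter> cball x R) = A \<inter> cball y R}"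
  unfolding motions_def using UD.wedge_closed[of A] by (auto simp: UD_act_def)

lemma D_UD: "D \<in> UD"
  using separated r by (auto simp: UD_def uniformly_discrete_def)

text \<open>Equality of the two sets follows from one inclusion, applied to the motion and to its inverse.
  The family \<open>M\<close> stands for the motions of any other pattern.\<close>

lemma UD_motionsI:
  assumes A: "A \<in> UD" and Q: "\<And>\<gamma> x y. \<gamma> \<in> M x y \<Longrightarrow> \<gamma> \<in> carrier G \<and> \<phi> \<gamma> x = y \<and> m_inv G \<gamma> \<in> M y x"
    and incl: "\<And>\<gamma> x y z. \<lbrakk>\<gamma> \<in> M x y; z \<in> A; dist x z \<le> R\<rbrakk> \<Longrightarrow> \<phi> \<gamma> z \<in> A"
  shows "M x y \<subseteq> UD.mot A R x y"
proof
  fix \<gamma> assume g: "\<gamma> \<in> M x y"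
  then have c: "\<gamma> \<in> carrier G" "\<phi> \<gamma> x = y" "m_inv G \<gamma> \<in> M y x"
    using Q by blast+
  have "\<phi> \<gamma> ` (A \<inter> cball x R) \<subseteq> A \<inter> cball y R"
    using incl[OF g] c by (auto simp: isometric)
  moreover have "z \<in> \<phi> \<gamma> ` (A \<inter> cball x R)" if z: "z \<in> A \<inter> cball y R" for z
  proof -
    have "\<phi> (m_inv G \<gamma>) z \<in> A \<inter> cball x R"
      using incl[OF c(3)] z isometric[of "m_inv G \<gamma>" y z] c by auto
    then show ?thesis
      using c(1) by (metis image_eqI space_inv(2))
  qed
  ultimately show "\<gamma> \<in> UD.mot A R x y"
    using A c by (auto simp: UD_motions_def)
qed

lemma motion_maps_D:
  assumes "\<gamma> \<in> mot P S x y" "z \<in> D" "dist x z \<le> L"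
  shows "\<phi> \<gamma> z \<in> D"
proof -
  have "\<phi> \<gamma> ` (D \<inter> cball x L) = D \<inter> cball y L"
    using assms(1) derived[of x y] D_UD by (auto simp: UD_motions_def)
  then show ?thesis
    using assms(2,3) by auto
qed

text \<open>Points of \<open>D\<close> are equivalent when some motion carries the patch of radius \<open>S\<close> at one to that at
  the other.  The choice depends on the class of \<open>x\<close> only (see \<open>class_rep_eq\<close>), since
  equivalent points satisfy the same defining predicate.\<close>

definition class_rep :: "'x \<Rightarrow> 'x" where
  "class_rep x = (SOME c. c \<in> D \<and> mot P S c x \<noteq> {})"

lemma class_rep:
  assumes "x \<in> D"
  shows "class_rep x \<in> D" "\<exists>\<gamma>. \<gamma> \<in> mot P S (class_rep x) x"
proof -
  have "x \<in> D \<and> mot P S x x \<noteq> {}"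
    using assms motions_one[OF P] by blast
  then have "class_rep x \<in> D \<and> mot P S (class_rep x) x \<noteq> {}"
    unfolding class_rep_def by (rule someI)
  then show "class_rep x \<in> D" "\<exists>\<gamma>. \<gamma> \<in> mot P S (class_rep x) x"
    by auto
qed

lemma class_rep_eq:
  assumes "\<gamma> \<in> mot P S x y"
  shows "class_rep x = class_rep y"
proof -
  have "mot P S c x \<noteq> {} \<longleftrightarrow> mot P S c y \<noteq> {}" for c
    using motions_mult[OF P _ assms] motions_mult[OF P _ motions_inv[OF P assms]] by blast
  then show ?thesis
    by (simp add: class_rep_def)
qed

definition direction :: "'x \<Rightarrow> 'x" where
  "direction c = (SOME p. norm p = 1 \<and>
     (\<forall>y\<in>D \<inter> cball c L. \<forall>z\<in>D \<inter> cball c L. y \<noteq> z \<longrightarrow> s \<le> \<bar>p \<bullet> (y - z)\<bar>))"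

lemma direction:
  assumes "c \<in> D"
  shows "norm (direction c) = 1"
    and "\<lbrakk>y \<in> D; dist c y \<le> L; z \<in> D; dist c z \<le> L; y \<noteq> z\<rbrakk> \<Longrightarrow> s \<le> \<bar>direction c \<bullet> (y - z)\<bar>"
  using someI_ex[OF directions[OF assms]] by (auto simp: direction_def)

text \<open>An injection of the countable set \<open>D\<close> into the interval from \<open>r/16\<close> to \<open>r/8\<close>: the
  lengths that name the classes must stay away from \<open>0\<close> to keep the marked set uniformly
  discrete, and far below \<open>r\<close> to keep flags of different points apart.\<close>

definition height :: "'x \<Rightarrow> real" where
  "height c = r / 16 * (1 + 1 / (real (to_nat_on D c) + 1))"

lemma height: "r / 16 \<le> height c" "height c \<le> r / 8"
  using r by (auto simp: height_def field_simps)

lemma height_inj: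
  assumes "c \<in> D" "d \<in> D" "height c = height d"
  shows "c = d"
proof -
  have "countable D"
    using separated_countable[OF r] separated by blast
  then have "inj_on (to_nat_on D) D"
    by (rule inj_on_to_nat_on)
  moreover have "to_nat_on D c = to_nat_on D d"
    using assms(3) r by (simp add: height_def)
  ultimately show ?thesis
    using assms by (auto dest: inj_onD)
qed

text \<open>The smallest length scale. The first bound makes it less than all distances between \<open>D\<close> and
  other marked points.  The second is half of the displacement that
  \<open>isometry_displacement_bound\<close> yields for the points at distance between \<open>r/16\<close> and \<open>r/4\<close> from
  \<open>c\<close> in the chosen direction.\<close>

definition gap :: real where
  "gap = min (r / 32) (r * s / (32 * (L + r / 4)))"

lemma gap: "gap > 0" "gap \<le> r / 32" "32 * (L + r / 4) * gap \<le> r * s"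
proof -
  have pos: "32 * (L + r / 4) > 0"
    using r L by simp
  show "gap > 0"
    using r s pos by (simp add: gap_def)
  show "gap \<le> r / 32"
    unfolding gap_def by (rule min.cobounded1)
  have "gap \<le> r * s / (32 * (L + r / 4))"
    unfolding gap_def by (rule min.cobounded2)
  then show "32 * (L + r / 4) * gap \<le> r * s"
    using pos by (simp add: pos_le_divide_eq mult.commute)
qed

definition tip :: "'x \<Rightarrow> real \<Rightarrow> 'x" where
  "tip c t = c + t *\<^sub>R direction c"

lemma dist_tip: "c \<in> D \<Longrightarrow> dist (tip c t) (tip c u) = \<bar>t - u\<bar>"
  by (simp add: tip_def dist_norm direction flip: scaleR_left_diff_distrib)

lemma dist_base_tip: "c \<in> D \<Longrightarrow> dist c (tip c t) = \<bar>t\<bar>"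
  by (simp add: tip_def dist_norm direction)

text \<open>Taking images under all motions from the representative makes the flag at \<open>x\<close>
  independent of the choice of a motion and gives it the symmetries of the patch at \<open>x\<close>.  The tips come in
  pairs at distance \<open>gap\<close> so that flag points can be told from points of \<open>D\<close>.\<close>

definition flag :: "'x \<Rightarrow> 'x set" where
  "flag x = {\<phi> \<gamma> (tip (class_rep x) t) | \<gamma> t. \<gamma> \<in> mot P S (class_rep x) x \<and>
     t \<in> {height (class_rep x), height (class_rep x) + gap}}"

definition marked :: "'x set" where
  "marked = D \<union> (\<Union>x\<in>D. flag x)"

text \<open>A nontrivial \<open>h\<close> moves some point \<open>y\<close> of \<open>D\<close> near \<open>c\<close> to another such point, so
  \<open>h y - y\<close> is one of the differences on which the direction at \<open>c\<close> has inner product at least \<open>s\<close>.\<close>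

lemma symmetry_moves_tip:
  assumes c: "c \<in> D" and h: "h \<in> UD.mot D L c c" "h \<noteq> \<one>\<^bsub>G\<^esub>" and t: "r / 16 \<le> t" "t \<le> r / 4"
  shows "2 * gap \<le> dist (\<phi> h (tip c t)) (tip c t)"
proof -
  have hc: "h \<in> carrier G" "\<phi> h c = c"
    and h_D: "\<And>y. \<lbrakk>y \<in> D; dist c y \<le> L\<rbrakk> \<Longrightarrow> \<phi> h y \<in> D \<and> dist c (\<phi> h y) \<le> L"
    using h(1) D_UD by (auto simp: UD_motions_def)
  have "\<exists>y\<in>D \<inter> cball c L. \<phi> h y \<noteq> y"
  proof (rule ccontr)
    assume "\<not> ?thesis"
    then have "\<phi> h z = z" for z
      using isometry_fixing_dense_patch[of "\<phi> h" D "L / 2" c z] dense L hc isometric by auto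
    then show False
      using faithful hc h(2) by blast
  qed
  then obtain y where y: "y \<in> D" "dist c y \<le> L" "\<phi> h y \<noteq> y"
    by auto
  have "(r / 16) * s \<le> t * \<bar>direction c \<bullet> (\<phi> h y - y)\<bar>"
    using t r s y h_D[OF y(1,2)] direction(2)[OF c] by (intro mult_mono) auto
  also have "\<dots> = \<bar>(tip c t - c) \<bullet> (\<phi> h y - y)\<bar>"
    using t r by (simp add: tip_def abs_mult)
  also have "\<dots> \<le> (L + r / 4) * dist (\<phi> h (tip c t)) (tip c t)"
    using isometry_displacement_bound[of "\<phi> h" c y L "tip c t" "r / 4"] isometric hc y t r
    by (simp add: dist_base_tip c)
  finally have "(L + r / 4) * (2 * gap) \<le> (L + r / 4) * dist (\<phi> h (tip c t)) (tip c t)"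
    using gap(3) by (simp add: algebra_simps)
  then show ?thesis
    using r L by (subst (asm) mult_le_cancel_left_pos) auto
qed

lemma flagE:
  assumes "z \<in> flag x" "x \<in> D"
  obtains \<gamma> t where "\<gamma> \<in> mot P S (class_rep x) x" "z = \<phi> \<gamma> (tip (class_rep x) t)"
    "t = height (class_rep x) \<or> t = height (class_rep x) + gap" "dist x z = t" "r / 16 \<le> t" "t \<le> r / 4"
proof -
  obtain \<gamma> t where g: "\<gamma> \<in> mot P S (class_rep x) x" "z = \<phi> \<gamma> (tip (class_rep x) t)"
    "t = height (class_rep x) \<or> t = height (class_rep x) + gap"
    using assms by (auto simp: flag_def)
  have t: "r / 16 \<le> t" "t \<le> r / 4"
    using g(3) height[of "class_rep x"] gap(1,2) r by auto
  have "\<gamma> \<in> carrier G" "\<phi> \<gamma> (class_rep x) = x"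
    using g(1) by (auto simp: motions_def)
  then have "dist x z = t"
    using isometric[of \<gamma> "class_rep x" "tip (class_rep x) t"] g t r class_rep[OF assms(2)]
    by (simp add: dist_base_tip)
  then show ?thesis
    using that g t by blast
qed

lemma flag_dist:
  assumes "z \<in> flag x" "x \<in> D"
  shows "r / 16 \<le> dist x z" "dist x z \<le> r / 4" "height (class_rep x) \<le> dist x z"
  using flagE[OF assms] gap(1) by (metis order_refl less_eq_real_def less_add_same_cancel1 add.commute)+

lemma flag_nonempty:
  assumes "x \<in> D"
  shows "\<exists>z\<in>flag x. dist x z = height (class_rep x)"
proof -
  obtain \<gamma> where g: "\<gamma> \<in> mot P S (class_rep x) x"
    using class_rep[OF assms] by blast
  let ?z = "\<phi> \<gamma> (tip (class_rep x) (height (class_rep x)))"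
  have "\<gamma> \<in> carrier G" "\<phi> \<gamma> (class_rep x) = x"
    using g by (auto simp: motions_def)
  then have "dist x ?z = height (class_rep x)"
    using isometric[of \<gamma> "class_rep x" "tip (class_rep x) (height (class_rep x))"]
      dist_base_tip[OF class_rep(1)[OF assms]] height(1)[of "class_rep x"] r by simp
  moreover have "?z \<in> flag x"
    using g by (auto simp: flag_def)
  ultimately show ?thesis by blast
qed

lemma flag_mate:
  assumes "z \<in> flag x" "x \<in> D"
  shows "\<exists>z'\<in>flag x. dist z z' = gap"
proof -
  let ?c = "class_rep x"
  obtain \<gamma> t where g: "\<gamma> \<in> mot P S ?c x" "z = \<phi> \<gamma> (tip ?c t)"
    "t = height ?c \<or> t = height ?c + gap"
    using flagE[OF assms] by metis
  \<comment> \<open>\<open>t\<close> and \<open>t'\<close> are the two heights, in either order.\<close>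
  define t' where "t' = 2 * height ?c + gap - t"
  have t': "t' = height ?c \<or> t' = height ?c + gap" "\<bar>t - t'\<bar> = gap"
    using g(3) gap(1) by (auto simp: t'_def)
  have "dist z (\<phi> \<gamma> (tip ?c t')) = gap"
    using g(1,2) t'(2) class_rep[OF assms(2)] by (simp add: motions_def isometric dist_tip)
  moreover have "\<phi> \<gamma> (tip ?c t') \<in> flag x"
    using g(1) t' by (auto simp: flag_def)
  ultimately show ?thesis by blast
qed

text \<open>Up to a motion, two points of the flag at \<open>x\<close> are a tip and the image of a tip under a
  symmetry \<open>h\<close> of the patch at the representative.  If \<open>h\<close> is trivial the two tips are different
  and \<open>gap\<close> apart; otherwise \<open>h\<close> moves its tip by at least \<open>2 * gap\<close>, and exchanging the tip for its
  mate loses at most one \<open>gap\<close>.\<close>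

lemma flag_separated:
  assumes z: "z \<in> flag x" "z' \<in> flag x" "z \<noteq> z'" and x: "x \<in> D"
  shows "gap \<le> dist z z'"
proof -
  let ?c = "class_rep x"
  have c: "?c \<in> D" using class_rep x by blast
  obtain \<gamma> t where g: "\<gamma> \<in> mot P S ?c x" "z = \<phi> \<gamma> (tip ?c t)"
    "t = height ?c \<or> t = height ?c + gap" "r / 16 \<le> t" "t \<le> r / 4"
    using flagE[OF z(1) x] by metis
  obtain \<gamma>' t' where g': "\<gamma>' \<in> mot P S ?c x" "z' = \<phi> \<gamma>' (tip ?c t')"
    "t' = height ?c \<or> t' = height ?c + gap"
    using flagE[OF z(2) x] by metis
  let ?h = "m_inv G \<gamma>' \<otimes>\<^bsub>G\<^esub> \<gamma>"
  have h: "?h \<in> mot P S ?c ?c"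
    using motions_mult[OF P g(1) motions_inv[OF P g'(1)]] .
  have car: "\<gamma> \<in> carrier G" "\<gamma>' \<in> carrier G"
    using g g' by (auto simp: motions_def)
  have dist_eq: "dist z z' = dist (\<phi> ?h (tip ?c t)) (tip ?c t')"
    using isometric[of "m_inv G \<gamma>'" z z'] g(2) g'(2) car by (simp add: space_mult)
  have tt: "\<bar>t - t'\<bar> \<le> gap" "t \<noteq> t' \<Longrightarrow> \<bar>t - t'\<bar> = gap"
    using g(3) g'(3) gap(1) by auto
  show ?thesis
  proof (cases "?h = \<one>\<^bsub>G\<^esub>")
    case True
    then have d: "dist z z' = \<bar>t - t'\<bar>"
      using dist_eq by (simp add: dist_tip c)
    then have "t \<noteq> t'"
      using z(3) by auto
    then show ?thesis
      using d tt by simp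
  next
    case False
    then have "2 * gap \<le> dist (\<phi> ?h (tip ?c t)) (tip ?c t)"
      using symmetry_moves_tip[OF c _ False g(4,5)] h derived by blast
    also have "\<dots> \<le> dist z z' + dist (tip ?c t') (tip ?c t)"
      unfolding dist_eq by (rule dist_triangle)
    finally show ?thesis
      using tt(1) by (simp add: dist_tip c abs_minus_commute)
  qed
qed

lemma flags_apart:
  assumes "x \<in> D" "y \<in> D" "x \<noteq> y" "z \<in> flag y"
  shows "dist x z > r / 2"
  using separated[OF assms(1-3)] flag_dist(2)[OF assms(4,2)] dist_triangle[of x y z] r
  by (simp add: dist_commute)

lemma marked_separated:
  assumes "z \<in> marked" "w \<in> marked" "z \<noteq> w"
  shows "gap \<le> dist z w"
proof -
  have DF: "gap \<le> dist x z" if "x \<in> D" "y \<in> D" "z \<in> flag y" for x y z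
    using flags_apart[OF that(1,2) _ that(3)] flag_dist(1)[OF that(3,2)] gap(2) r by (cases "x = y") auto
  have FF: "gap \<le> dist z w" if "x \<in> D" "z \<in> flag x" "y \<in> D" "w \<in> flag y" for x y
  proof (cases "x = y")
    case True
    then show ?thesis
      using flag_separated that assms(3) by blast
  next
    case False
    then have "dist x w > r / 2"
      using flags_apart that by blast
    then show ?thesis
      using flag_dist(2)[OF that(2,1)] dist_triangle[of x w z] gap(2) r by simp
  qed
  show ?thesis
  proof (cases "z \<in> D")
    case z: True
    show ?thesis
    proof (cases "w \<in> D")
      case True
      then show ?thesis
        using separated[OF z True assms(3)] gap(2) r by linarith
    next
      case False
      then show ?thesis
        using DF[OF z] assms(2) unfolding marked_def by blast
    qed
  next
    case False
    then obtain x where x: "x \<in> D" "z \<in> flag x"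
      using assms(1) by (auto simp: marked_def)
    show ?thesis
    proof (cases "w \<in> D")
      case True
      then show ?thesis
        using DF[OF True x] by (simp add: dist_commute)
    next
      case False
      then show ?thesis
        using FF[OF x] assms(2) unfolding marked_def by blast
    qed
  qed
qed

lemma marked_UD: "marked \<in> UD"
proof -
  have "gap / 2 < dist z w" if "z \<in> marked" "w \<in> marked" "z \<noteq> w" for z w
    using marked_separated[OF that] gap(1) by linarith
  then show ?thesis
    unfolding UD_def uniformly_discrete_def using gap(1) by (auto intro!: exI[of _ "gap / 2"])
qed

lemma D_iff_isolated: "z \<in> D \<longleftrightarrow> z \<in> marked \<and> (\<forall>w\<in>marked. w \<noteq> z \<longrightarrow> gap < dist z w)"
proof
  assume z: "z \<in> D"
  have "gap < dist z w" if w: "w \<in> marked" "w \<noteq> z" for w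
  proof (cases "w \<in> D")
    case True
    then show ?thesis using separated[of z w] z w gap(2) r by auto
  next
    case False
    then obtain y where y: "y \<in> D" "w \<in> flag y"
      using w by (auto simp: marked_def)
    then show ?thesis
      using flags_apart[OF z y(1) _ y(2)] flag_dist(1)[OF y(2,1)] gap(2) r by (cases "z = y") auto
  qed
  then show "z \<in> marked \<and> (\<forall>w\<in>marked. w \<noteq> z \<longrightarrow> gap < dist z w)"
    using z by (auto simp: marked_def)
next
  assume z: "z \<in> marked \<and> (\<forall>w\<in>marked. w \<noteq> z \<longrightarrow> gap < dist z w)"
  show "z \<in> D"
  proof (rule ccontr)
    assume "z \<notin> D"
    then obtain x where x: "x \<in> D" "z \<in> flag x"
      using z by (auto simp: marked_def)
    then obtain z' where "z' \<in> flag x" "dist z z' = gap"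
      using flag_mate by blast
    moreover from this have "z' \<in> marked" "z' \<noteq> z"
      using x(1) gap(1) by (auto simp: marked_def)
    ultimately show False
      using z by auto
  qed
qed

lemma flag_iff:
  assumes x: "x \<in> D"
  shows "z \<in> flag x \<longleftrightarrow> z \<in> marked \<and> z \<noteq> x \<and> dist x z \<le> r / 4"
proof
  assume "z \<in> flag x"
  then show "z \<in> marked \<and> z \<noteq> x \<and> dist x z \<le> r / 4"
    using flag_dist[of z x] x r by (auto simp: marked_def)
next
  assume z: "z \<in> marked \<and> z \<noteq> x \<and> dist x z \<le> r / 4"
  then have "z \<notin> D"
    using separated[of x z] x r by auto
  then obtain y where "y \<in> D" "z \<in> flag y"
    using z by (auto simp: marked_def)
  then show "z \<in> flag x"
    using flags_apart[OF x] z r by force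
qed

section \<open>Mutual derivability of the pattern and the marked set\<close>

text \<open>A point of \<open>flag w\<close> is the image of a tip under some motion to \<open>w\<close>; a motion of the patch
  at \<open>w\<close> can be composed with it, which again gives a flag point.\<close>

lemma marked_derived_from_P:
  "mot P (R + (S + r / 4)) x y \<subseteq> UD.mot marked R x y"
proof (rule UD_motionsI[OF marked_UD])
  fix \<gamma> x y z
  assume g: "\<gamma> \<in> mot P (R + (S + r / 4)) x y" and z: "z \<in> marked" "dist x z \<le> R"
  have local: "\<gamma> \<in> mot P S w (\<phi> \<gamma> w)" if "dist x w \<le> R + r / 4" for w
    using motions_shrink[OF P g] that by simp
  have in_D: "\<phi> \<gamma> w \<in> D" if "w \<in> D" "dist x w \<le> R + r / 4" for w
    using motion_maps_D[OF local[OF that(2)] that(1)] L by simp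
  show "\<phi> \<gamma> z \<in> marked"
  proof (cases "z \<in> D")
    case True
    then show ?thesis
      using in_D z r by (simp add: marked_def)
  next
    case False
    then obtain w where w: "w \<in> D" "z \<in> flag w"
      using z by (auto simp: marked_def)
    have near: "dist x w \<le> R + r / 4"
      using z(2) flag_dist(2)[OF w(2,1)] dist_triangle[of x w z] by (simp add: dist_commute)
    obtain \<delta> t where d: "\<delta> \<in> mot P S (class_rep w) w" "z = \<phi> \<delta> (tip (class_rep w) t)"
      "t = height (class_rep w) \<or> t = height (class_rep w) + gap"
      using flagE[OF w(2,1)] by metis
    have car: "\<gamma> \<in> carrier G" "\<delta> \<in> carrier G"
      using g d by (auto simp: motions_def)
    have "class_rep (\<phi> \<gamma> w) = class_rep w"
      using class_rep_eq[OF local[OF near]] by simp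
    then have "\<phi> (\<gamma> \<otimes>\<^bsub>G\<^esub> \<delta>) (tip (class_rep w) t) \<in> flag (\<phi> \<gamma> w)"
      using motions_mult[OF P d(1) local[OF near]] d(3) unfolding flag_def by auto
    then show ?thesis
      using in_D[OF w(1) near] d(2) car by (auto simp: marked_def space_mult)
  qed
next
  fix \<gamma> x y assume "\<gamma> \<in> mot P (R + (S + r / 4)) x y"
  then show "\<gamma> \<in> carrier G \<and> \<phi> \<gamma> x = y \<and> m_inv G \<gamma> \<in> mot P (R + (S + r / 4)) y x"
    using motions_inv[OF P] by (auto simp: motions_def)
qed

text \<open>Membership in \<open>D\<close> is visible in the marked set within distance \<open>gap\<close>, by
  \<open>D_iff_isolated\<close>.\<close>

lemma D_derived_from_marked:
  "UD.mot marked (R + gap) x y \<subseteq> UD.mot D R x y"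
proof (rule UD_motionsI[OF D_UD])
  fix \<gamma> x y z
  assume g: "\<gamma> \<in> UD.mot marked (R + gap) x y" and z: "z \<in> D" "dist x z \<le> R"
  have car: "\<gamma> \<in> carrier G" "\<phi> \<gamma> x = y"
    and img: "\<phi> \<gamma> ` (marked \<inter> cball x (R + gap)) = marked \<inter> cball y (R + gap)"
    using g marked_UD by (auto simp: UD_motions_def)
  have "gap < dist (\<phi> \<gamma> z) w" if w: "w \<in> marked" "w \<noteq> \<phi> \<gamma> z" for w
  proof (rule ccontr)
    assume "\<not> gap < dist (\<phi> \<gamma> z) w"
    moreover have "dist y (\<phi> \<gamma> z) \<le> R"
      using z(2) car isometric[of \<gamma> x z] by simp
    ultimately have "w \<in> marked \<inter> cball y (R + gap)"
      using w dist_triangle[of y w "\<phi> \<gamma> z"] by simp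
    then obtain v where v: "v \<in> marked" "w = \<phi> \<gamma> v"
      unfolding img[symmetric] by blast
    then have "gap < dist z v"
      using D_iff_isolated[of z] z w by auto
    then show False
      using \<open>\<not> gap < dist (\<phi> \<gamma> z) w\<close> v car isometric by simp
  qed
  moreover have "\<phi> \<gamma> z \<in> marked"
    using img z gap(1) D_iff_isolated[of z] by fastforce
  ultimately show "\<phi> \<gamma> z \<in> D"
    using D_iff_isolated by blast
next
  fix \<gamma> x y assume "\<gamma> \<in> UD.mot marked (R + gap) x y"
  then show "\<gamma> \<in> carrier G \<and> \<phi> \<gamma> x = y \<and> m_inv G \<gamma> \<in> UD.mot marked (R + gap) y x"
    using UD.motions_inv[OF marked_UD] by (auto simp: motions_def)
qed

lemma image_flag:
  assumes g: "\<gamma> \<in> UD.mot marked (r / 4) x y" and "x \<in> D" "y \<in> D"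
  shows "\<phi> \<gamma> ` flag x = flag y"
proof -
  have car: "\<gamma> \<in> carrier G" "\<phi> \<gamma> x = y"
    and img: "\<phi> \<gamma> ` (marked \<inter> cball x (r / 4)) = marked \<inter> cball y (r / 4)"
    using g marked_UD by (auto simp: UD_motions_def)
  have flag: "flag v = marked \<inter> cball v (r / 4) - {v}" if v: "v \<in> D" for v
    by (rule Set.set_eqI, unfold flag_iff[OF v]) auto
  have "inj (\<phi> \<gamma>)"
    using space_inv(1)[OF car(1)] by (metis injI)
  then show ?thesis
    using assms(2,3) car img by (simp add: flag image_set_diff)
qed

text \<open>A motion \<open>\<gamma>\<close> of the marked set carries \<open>flag y\<close> to \<open>flag y'\<close>; comparing
  the smallest distances to the centre shows that both patches are in the class of the same \<open>c\<close>.
  Pick the motions \<open>\<delta>\<close>, \<open>\<delta>'\<close> of \<open>P\<close> that produce a tip of \<open>flag y\<close> and its image under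
  \<open>\<gamma>\<close>.  Then \<open>\<delta>'\<^sup>-\<^sup>1 \<gamma> \<delta>\<close> is a symmetry of \<open>D \<inter> B(c, L)\<close> that fixes a tip, hence is
  trivial, and \<open>\<gamma> = \<delta>' \<delta>\<^sup>-\<^sup>1\<close> is a motion of \<open>P\<close>.\<close>

lemma P_motion_at_D:
  assumes g: "\<gamma> \<in> UD.mot marked (L + r / 4) y y'" and y: "y \<in> D"
  shows "\<gamma> \<in> mot P S y y'"
proof -
  have car: "\<gamma> \<in> carrier G" "\<phi> \<gamma> y = y'"
    using g by (auto simp: motions_def)
  have "\<gamma> \<in> UD.mot marked (L + gap) y y'"
    using UD.motions_shrink[OF marked_UD g, of y "L + gap"] gap r car by simp
  then have gD: "\<gamma> \<in> UD.mot D L y y'"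
    using D_derived_from_marked by blast
  then have y': "y' \<in> D"
    using y L D_UD car by (auto simp: UD_motions_def)
  have "\<gamma> \<in> UD.mot marked (r / 4) y y'"
    using UD.motions_shrink[OF marked_UD g, of y "r / 4"] L car by simp
  then have flag: "\<phi> \<gamma> ` flag y = flag y'"
    using image_flag y y' by blast
  have dist: "dist y' (\<phi> \<gamma> z) = dist y z" for z
    using isometric[of \<gamma> y z] car by simp
  have "height (class_rep y) = height (class_rep y')"
  proof (rule antisym)
    obtain z where z: "z \<in> flag y" "dist y' (\<phi> \<gamma> z) = height (class_rep y')"
      using flag_nonempty[OF y'] unfolding flag[symmetric] by blast
    show "height (class_rep y) \<le> height (class_rep y')"
      using flag_dist(3)[OF z(1) y] unfolding z(2)[symmetric] dist .
    obtain z where z: "z \<in> flag y" "dist y z = height (class_rep y)"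
      using flag_nonempty[OF y] by blast
    then have "\<phi> \<gamma> z \<in> flag y'"
      unfolding flag[symmetric] by blast
    then show "height (class_rep y') \<le> height (class_rep y)"
      using flag_dist(3)[OF _ y', of "\<phi> \<gamma> z"] by (simp add: z(2) dist)
  qed
  then have rep: "class_rep y' = class_rep y"
    using height_inj class_rep(1) y y' by metis
  let ?c = "class_rep y" and ?t = "height (class_rep y)"
  have c: "?c \<in> D" using class_rep y by blast
  obtain z where z: "z \<in> flag y" "dist y z = ?t"
    using flag_nonempty[OF y] by blast
  obtain \<delta> where d: "\<delta> \<in> mot P S ?c y" "z = \<phi> \<delta> (tip ?c ?t)"
    using flagE[OF z(1) y] z(2) by metis
  have z': "\<phi> \<gamma> z \<in> flag y'" "dist y' (\<phi> \<gamma> z) = ?t"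
    using z flag dist by auto
  obtain \<delta>' where d': "\<delta>' \<in> mot P S ?c y'" "\<phi> \<gamma> z = \<phi> \<delta>' (tip ?c ?t)"
    using flagE[OF z'(1) y'] z'(2) rep by metis
  have car': "\<delta> \<in> carrier G" "\<delta>' \<in> carrier G"
    using d d' by (auto simp: motions_def)
  let ?h = "m_inv G \<delta>' \<otimes>\<^bsub>G\<^esub> (\<gamma> \<otimes>\<^bsub>G\<^esub> \<delta>)"
  have "?h \<in> UD.mot D L ?c ?c"
    using d(1) d'(1) derived gD D_UD
    by (intro UD.motions_mult[where y = y'] UD.motions_mult[where y = y] UD.motions_inv) auto
  moreover have "\<phi> ?h (tip ?c ?t) = tip ?c ?t"
    using car car' d(2) d'(2) by (simp add: space_mult flip: d(2))
  moreover have "r / 16 \<le> ?t" "?t \<le> r / 4"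
    using height[of ?c] r by auto
  ultimately have "?h = \<one>\<^bsub>G\<^esub>"
    using symmetry_moves_tip[OF c, of ?h ?t] gap(1) by fastforce
  then have "\<gamma> = \<delta>' \<otimes>\<^bsub>G\<^esub> m_inv G \<delta>"
    using car car' by (metis inv_closed inv_equality inv_inv inv_solve_right m_closed)
  then show ?thesis
    using motions_mult[OF P motions_inv[OF P d(1)] d'(1)] by simp
qed

text \<open>Let \<open>\<gamma>\<close> be a motion of the marked set on a large ball.  Then \<open>P\<close> and \<open>\<gamma>\<^sup>-\<^sup>1 P\<close> agree
  on \<open>B(z, S)\<close> for all \<open>z \<in> D\<close> near \<open>B(x, R)\<close>.  By bounded components, a point \<open>u\<close> in the
  support of either pattern cut to \<open>B(x, R)\<close> is already in the support of its cut-off to \<open>B(u, b)\<close>,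
  which lies in one of these balls.  So glueing shows that they agree on \<open>B(x, R)\<close>.\<close>

lemma P_derived_from_marked:
  assumes glueable: "glueable PS wedge"
    and bounded: "\<And>C u. \<lbrakk>closed C; u \<in> supp wedge (wedge P C)\<rbrakk> \<Longrightarrow> u \<in> supp wedge (wedge (wedge P C) (cball u b))"
    and S_large: "b + L / 2 \<le> S"
  shows "UD.mot marked (R + (3 / 2 * L + r / 4)) x y \<subseteq> mot P R x y"
proof
  fix \<gamma> assume g: "\<gamma> \<in> UD.mot marked (R + (3 / 2 * L + r / 4)) x y"
  have car: "\<gamma> \<in> carrier G" "\<phi> \<gamma> x = y"
    using g by (auto simp: motions_def)
  let ?I = "D \<inter> cball x (R + L / 2)" and ?Q = "act (m_inv G \<gamma>) P"
  have Q: "?Q \<in> PS"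
    using car P by (simp add: pattern_closed)
  have bounded_Q: "u \<in> supp wedge (wedge (wedge ?Q C) (cball u b))"
    if "closed C" "u \<in> supp wedge (wedge ?Q C)" for C u
    using bounded_components_act[OF _ P bounded that] car by simp
  have eq: "wedge P (cball z S) = wedge ?Q (cball z S)" if z: "z \<in> ?I" for z
  proof -
    have "\<gamma> \<in> UD.mot marked (L + r / 4) z (\<phi> \<gamma> z)"
      using UD.motions_shrink[OF marked_UD g, of z] z by simp
    then have "\<gamma> \<in> mot P S z (\<phi> \<gamma> z)"
      using P_motion_at_D z by blast
    then have "m_inv G \<gamma> \<in> mot P S (\<phi> \<gamma> z) z"
      by (rule motions_inv[OF P])
    then show ?thesis
      using P by (simp add: motions_iff)
  qed
  have cover: "supp wedge (wedge U (cball x R)) \<subseteq> (\<Union>z\<in>?I. supp wedge (wedge U (cball z S)))"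
    if U: "U \<in> PS" and bounded_U: "\<And>C u. \<lbrakk>closed C; u \<in> supp wedge (wedge U C)\<rbrakk> \<Longrightarrow>
      u \<in> supp wedge (wedge (wedge U C) (cball u b))" for U
  proof
    fix u assume u: "u \<in> supp wedge (wedge U (cball x R))"
    then have ux: "dist x u \<le> R"
      using supp_wedge_subset[OF U, of "cball x R"] by auto
    obtain z where z: "z \<in> D" "dist u z < L / 2"
      using dense by blast
    have "cball u b \<subseteq> cball z S"
      using z S_large by (intro cball_subset_cballI) (simp add: dist_commute)
    then have "supp wedge (wedge U (cball x R \<inter> cball u b)) \<subseteq> supp wedge (wedge U (cball z S))"
      using U by (intro supp_wedge_mono) auto
    moreover have "u \<in> supp wedge (wedge U (cball x R \<inter> cball u b))"
      using bounded_U[OF _ u] U by (simp add: wedge_wedge)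
    moreover have "z \<in> ?I"
      using z ux dist_triangle[of x z u] by simp
    ultimately show "u \<in> (\<Union>z\<in>?I. supp wedge (wedge U (cball z S)))"
      by blast
  qed
  have "finite ?I"
    using separated_card_bound[OF r] separated by metis
  then have lub: "\<exists>T. is_lub (pattern_order PS wedge) T ((\<lambda>z. wedge P (cball z S)) ` ?I)"
    by (rule finite_pieces_have_lub[OF glueable P]) simp
  have "wedge P (cball x R) = wedge ?Q (cball x R)"
    by (rule wedge_eq_by_glueing[OF lub P Q closed_cball closed_cball eq cover[OF P bounded] cover[OF Q bounded_Q]])
  then have "m_inv G \<gamma> \<in> mot P R y x"
    using P car by (auto simp: motions_iff)
  then show "\<gamma> \<in> mot P R x y"
    using motions_inv[OF P] car by fastforce
qed

end


section \<open>Every Delone-deriving pattern is encoded by a Delone set\<close>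

theorem corollary4p27:
  fixes \<Gamma> :: "((real^'n) \<Rightarrow> (real^'n)) set"
    and PS :: "'p set"
    and wedge :: "'p \<Rightarrow> (real^'n) set \<Rightarrow> 'p"
    and act :: "((real^'n) \<Rightarrow> (real^'n)) \<Rightarrow> 'p \<Rightarrow> 'p"
    and P :: 'p
  defines "G \<equiv> isometry_group\<lparr>carrier := \<Gamma>\<rparr>"
  assumes "closed_subgroup_E \<Gamma>"
    and "\<And>v. (\<lambda>x. v + x) \<in> \<Gamma>"
    and "abstract_pattern_space_over G (\<lambda>\<gamma>. \<gamma>) PS wedge act"
    and "glueable PS wedge"
    and "P \<in> PS"
    and "bounded_components wedge P"
    and "delone_deriving G (\<lambda>\<gamma>. \<gamma>) wedge act P"
  shows "\<exists>D. delone D \<and> mutually_locally_derivable G wedge act P (\<inter>) (UD_act (\<lambda>\<gamma>. \<gamma>)) D"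
proof -
  note P = \<open>P \<in> PS\<close>
  have isometry: "dist (\<gamma> x) (\<gamma> y) = dist x y" if "\<gamma> \<in> carrier G" for \<gamma> x y
  proof -
    have "\<gamma> \<in> carrier isometry_group"
      using assms(2) that subgroup.subset unfolding closed_subgroup_E_def G_def by fastforce
    then show ?thesis
      by (simp add: isometry_group_def)
  qed
  then interpret isometric_pattern_space G "\<lambda>\<gamma>. \<gamma>" PS wedge act
    using assms(4) by (simp add: isometric_pattern_space_def isometric_pattern_space_axioms_def)
  have transitive: "\<exists>\<gamma>\<in>carrier G. \<gamma> x = y" for x y
    using assms(3)[of "y - x"] by (intro bexI[of _ "\<lambda>z. (y - x) + z"]) (auto simp: G_def)
  interpret UD: isometric_pattern_space G "\<lambda>\<gamma>. \<gamma>" UD "(\<inter>)" "UD_act (\<lambda>\<gamma>. \<gamma>)"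
    by (rule isometric_pattern_space_UD)
  note derivable_iff = locally_derivable_iff_motions[OF _ _ _ _ transitive]

  obtain b where b: "b > 0" and bounded:
    "\<And>C u. \<lbrakk>closed C; u \<in> supp wedge (wedge P C)\<rbrakk> \<Longrightarrow> u \<in> supp wedge (wedge (wedge P C) (cball u b))"
    using assms(7) unfolding bounded_components_def by blast
  obtain D where D: "delone D" "locally_derivable G wedge act P (\<inter>) (UD_act (\<lambda>\<gamma>. \<gamma>)) D"
    using assms(8) unfolding delone_deriving_def by blast
  obtain r where r: "r > 0" and separated: "\<forall>x\<in>D. \<forall>y\<in>D. x \<noteq> y \<longrightarrow> dist x y > r"
    using D(1) unfolding delone_def uniformly_discrete_def by blast
  obtain \<rho> where rho: "\<rho> > 0" and rho_dense: "\<And>x. \<exists>y\<in>D. dist x y < \<rho>"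
    using D(1) unfolding delone_def relatively_dense_def by (auto simp: interior_cball) (metis IntE ex_in_conv mem_ball)
  have "D \<in> UD"
    using D(1) by (simp add: delone_def UD_def)
  then obtain R0 where R0: "R0 \<ge> 0"
    and derived: "\<And>R x y. R \<ge> 0 \<Longrightarrow> mot P (R + R0) x y \<subseteq> UD.mot D R x y"
    using derivable_iff[OF isometric_pattern_space_axioms UD.isometric_pattern_space_axioms P, THEN iffD1, OF _ D(2)]
    by auto
  define L where "L = 2 * \<rho>"
  \<comment> \<open>The first bound lets patches of radius \<open>S\<close> determine \<open>D\<close>; the second makes them contain
    the components of \<open>P\<close> at all points within \<open>\<rho>\<close> of their centres.\<close>
  define S where "S = max (L + R0) (b + \<rho>)"
  obtain N where N: "\<And>(A :: (real^'n) set) c. \<forall>x\<in>A. \<forall>y\<in>A. x \<noteq> y \<longrightarrow> dist x y > r \<Longrightarrow>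
      finite (A \<inter> cball c L) \<and> card (A \<inter> cball c L) \<le> N"
    using separated_card_bound[OF r] by blast
  interpret marked_pattern G "\<lambda>\<gamma>. \<gamma>" PS wedge act P D r L S "r * (1/4) ^ (N * N)"
  proof
    fix \<gamma> assume "\<gamma> \<in> carrier G" "\<And>x. \<gamma> x = x"
    then show "\<gamma> = \<one>\<^bsub>G\<^esub>"
      by (auto simp: G_def isometry_group_def)
  next
    fix x y
    show "mot P S x y \<subseteq> UD.mot D L x y"
    proof
      fix \<gamma> assume g: "\<gamma> \<in> mot P S x y"
      then have "\<gamma> \<in> mot P (L + R0) x (\<gamma> x)"
        by (rule motions_shrink[OF P]) (simp add: S_def)
      moreover have "\<gamma> x = y"
        using g by (simp add: motions_def)
      ultimately show "\<gamma> \<in> UD.mot D L x y"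
        using derived[of L] rho by (auto simp: L_def)
    qed
  next
    fix c
    show "\<exists>p. norm p = 1 \<and> (\<forall>y\<in>D \<inter> cball c L. \<forall>z\<in>D \<inter> cball c L. y \<noteq> z \<longrightarrow>
      r * (1/4) ^ (N * N) \<le> \<bar>p \<bullet> (y - z)\<bar>)"
      using N[OF separated, of c] separated r by (intro exists_direction_separating_points) auto
  next
    show "L \<le> S"
      using R0 by (simp add: S_def)
  qed (use P r rho separated rho_dense in \<open>auto simp: L_def\<close>)

  have "delone marked"
    unfolding delone_def
  proof
    show "uniformly_discrete marked"
      using marked_UD by (simp add: UD_def)
    have "marked \<inter> interior (cball x \<rho>) \<noteq> {}" for x
      using rho_dense[of x] by (auto simp: interior_cball marked_def)
    then show "relatively_dense marked"
      using rho unfolding relatively_dense_def by blast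
  qed
  moreover have "locally_derivable G wedge act P (\<inter>) (UD_act (\<lambda>\<gamma>. \<gamma>)) marked"
    unfolding derivable_iff[OF isometric_pattern_space_axioms UD.isometric_pattern_space_axioms P marked_UD]
    using marked_derived_from_P r L S by (intro exI[of _ "S + r / 4"]) auto
  moreover have "locally_derivable G (\<inter>) (UD_act (\<lambda>\<gamma>. \<gamma>)) marked wedge act P"
    unfolding derivable_iff[OF UD.isometric_pattern_space_axioms isometric_pattern_space_axioms marked_UD P]
  proof (intro exI[of _ "3 / 2 * L + r / 4"] conjI allI impI)
    show "0 \<le> 3 / 2 * L + r / 4"
      using r L by simp
    fix R x y
    show "UD.mot marked (R + (3 / 2 * L + r / 4)) x y \<subseteq> mot P R x y"
      by (rule P_derived_from_marked[OF assms(5) bounded]) (simp_all add: S_def L_def)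
  qed
  ultimately show ?thesis
    unfolding mutually_locally_derivable_def by blast
qed

end
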